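(* Let $d\ge1$ and let $\boldsymbol\tau=\boldsymbol\tau^{0:K}:(0,1)^d\to\mathbb{R}^d$ be the Euler-discretized diffusion transport map (defined in the context) with vector field $\boldsymbol v_\theta$ on $\mathbb{R}^d\times[0,T]$ and $K$ Euler steps. Assume that for every multi-index $\beta\in\mathbb{N}_0^d$ with $0\le|\beta|\le d+1$ there is $M_\beta<\infty$ such that for all $j\in\{1,\dots,d\}$, $\sup_{\mathbf x\in\mathbb{R}^d,\,t\in[0,T]}|\partial_{\mathbf x}^\beta v_{\theta,j}(\mathbf x,t)|\le M_\beta$. Then for all $v\subseteq\{1,\dots,d\}$, all $i,j\in\{1,\dots,d\}$ and for arbitrarily small $B>0$ there exists $C_3>0$ such that for all $\mathbf u\in(0,1)^d$, $$\bigl|\partial^v(\partial^{\{i\}}\tau_j)(\mathbf u)\bigr|\le C_3\,\min(u_i,1-u_i)^{-1}\prod_{k=1}^d\min(u_k,1-u_k)^{-B-\mathbf 1_{\{k\in v\}}}.$$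
   Context: For $v\subseteq\{1,\dots,d\}$, $\partial^v=\prod_{j\in v}\partial/\partial u_j$ is the mixed partial derivative taken once in each coordinate of $v$ ($\partial^\emptyset$ is the identity); $\partial^{\{i\}}=\partial/\partial u_i$, and $i\in v$ is allowed. "For arbitrarily small $B>0$" means for every $B>0$, with the constant allowed to depend on $B$. Derivatives of $\boldsymbol v_\theta$ in the hypothesis are understood to exist and be continuous in the space variable. Diffusion transport map: let $T>0$, let $K\ge1$ be the number of Euler steps, $\eta=T/K$ the step size, and $t_k=T-k\eta$ for $k=0,\dots,K$. The vector field is $\boldsymbol v_\theta:\mathbb{R}^d\times[0,T]\to\mathbb{R}^d$, $\boldsymbol v_\theta(\mathbf x,t)=\mathbf f(\mathbf x,t)-\frac12 g(t)^2\mathbf s_\theta(\mathbf x,t)$, where $\mathbf f$ and $g$ are the drift and diffusion coefficients of a diffusion $d\mathbf x=\mathbf f(\mathbf x,t)\,dt+g(t)\,d\mathbf w$ and $\mathbf s_\theta$ is a (learned) score function; its components are $v_{\theta,j}$. Let $\Phi$ be the standard normal CDF and $G(\mathbf u)=(\Phi^{-1}(u_1),\dots,\Phi^{-1}(u_d))$ for $\mathbf u\in(0,1)^d$. The Euler step maps are $\boldsymbol\tau^k(\mathbf x)=\mathbf x-\eta\,\boldsymbol v_\theta(\mathbf x,t_k)$, $k=0,\dots,K-1$, and $\boldsymbol\tau^{0:K}=\boldsymbol\tau^{K-1}\circ\cdots\circ\boldsymbol\tau^0\circ G$, with components $\tau_j$. *)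

theory Defs
  imports "HOL-Probability.Probability"
begin

definition partial_deriv :: "'d::finite \<Rightarrow> (real^'d \<Rightarrow> real) \<Rightarrow> real^'d \<Rightarrow> real" where
  "partial_deriv i f x = deriv (\<lambda>h. f (x + h *\<^sub>R axis i 1)) 0"

definition has_partial_deriv :: "'d::finite \<Rightarrow> (real^'d \<Rightarrow> real) \<Rightarrow> real^'d \<Rightarrow> bool" where
  "has_partial_deriv i f x \<longleftrightarrow> (\<lambda>h. f (x + h *\<^sub>R axis i 1)) differentiable (at 0)"

text \<open>
  \<open>Ck_on k S f\<close>, meant for open \<open>S\<close>: all iterated partial derivatives of \<open>f\<close> of order at most
  \<open>k\<close>, in every order of differentiation, exist and are continuous on \<open>S\<close>.
\<close>

primrec Ck_on :: "nat \<Rightarrow> (real^'d::finite) set \<Rightarrow> (real^'d \<Rightarrow> real) \<Rightarrow> bool" where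
  "Ck_on 0 S f \<longleftrightarrow> continuous_on S f"
| "Ck_on (Suc k) S f \<longleftrightarrow>
     continuous_on S f \<and> (\<forall>i. (\<forall>x\<in>S. has_partial_deriv i f x) \<and> Ck_on k S (partial_deriv i f))"

text \<open>
  \<open>mixed_partial \<beta>\<close> is the operator \<open>\<partial>\<^sup>\<beta>\<close> for a multi-index \<open>\<beta>\<close>. The index type carries no
  order, so an arbitrary sequence of coordinates containing each \<open>i\<close> exactly \<open>\<beta> i\<close> times is
  chosen; for functions that are \<open>|\<beta>|\<close> times continuously differentiable on an open set, the
  choice is irrelevant there by the symmetry of mixed partial derivatives.
\<close>

definition mixed_partial :: "('d::finite \<Rightarrow> nat) \<Rightarrow> (real^'d \<Rightarrow> real) \<Rightarrow> real^'d \<Rightarrow> real" where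
  "mixed_partial \<beta> f = foldr partial_deriv (SOME is. \<forall>i. count_list is i = \<beta> i) f"

definition unit_cube :: "(real^'d::finite) set" where
  "unit_cube = {u. \<forall>k. 0 < u $ k \<and> u $ k < 1}"

definition std_normal_cdf :: "real \<Rightarrow> real" where
  "std_normal_cdf = cdf std_normal_distribution"

text \<open>The inverse is the true inverse on \<open>(0,1)\<close>; values outside the unit cube are junk.\<close>

definition normal_quantile_map :: "real^'d::finite \<Rightarrow> real^'d" where
  "normal_quantile_map u = (\<chi> k. inv std_normal_cdf (u $ k))"

definition flow_field ::
  "(real^'d::finite \<Rightarrow> real \<Rightarrow> real^'d) \<Rightarrow> (real \<Rightarrow> real) \<Rightarrow> (real^'d \<Rightarrow> real \<Rightarrow> real^'d)
    \<Rightarrow> real^'d \<Rightarrow> real \<Rightarrow> real^'d" where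
  "flow_field f g s x t = f x t - ((1/2) * (g t)^2) *\<^sub>R s x t"

definition euler_step ::
  "(real^'d::finite \<Rightarrow> real \<Rightarrow> real^'d) \<Rightarrow> real \<Rightarrow> nat \<Rightarrow> nat \<Rightarrow> real^'d \<Rightarrow> real^'d" where
  "euler_step V T K k x = (let \<eta> = T / real K in x - \<eta> *\<^sub>R V x (T - real k * \<eta>))"

text \<open>The first \<open>n\<close> of \<open>K\<close> Euler steps; the step size \<open>T / K\<close> does not depend on \<open>n\<close>.\<close>

primrec euler_steps ::
  "(real^'d::finite \<Rightarrow> real \<Rightarrow> real^'d) \<Rightarrow> real \<Rightarrow> nat \<Rightarrow> nat \<Rightarrow> real^'d \<Rightarrow> real^'d" where
  "euler_steps V T K 0 = id"
| "euler_steps V T K (Suc n) = euler_step V T K n \<circ> euler_steps V T K n"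

definition transport_map ::
  "(real^'d::finite \<Rightarrow> real \<Rightarrow> real^'d) \<Rightarrow> real \<Rightarrow> nat \<Rightarrow> real^'d \<Rightarrow> real^'d" where
  "transport_map V T K = euler_steps V T K K \<circ> normal_quantile_map"

end

theory Submission
  imports Defs "HOL-Real_Asymp.Real_Asymp"
begin

text \<open>
  Write \<open>\<tau> = F \<circ> G\<close> with \<open>F\<close> the composed Euler steps and \<open>G\<close> the coordinatewise normal quantile
  map. Each component of \<open>F\<close> is a coordinate plus a function with bounded derivatives, so all
  derivatives of \<open>F\<close> of order between \<open>1\<close> and \<open>d + 1\<close> are bounded. Since \<open>G\<close> acts coordinatewise,
  distinct coordinates each contribute one factor \<open>q'(u\<^sub>k) = 1 / \<phi>(q(u\<^sub>k))\<close> with \<open>q = \<Phi>\<^sup>-\<^sup>1\<close>; differentiating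
  once more in \<open>u\<^sub>i\<close> may produce \<open>q''(u\<^sub>i) = q(u\<^sub>i) q'(u\<^sub>i)\<^sup>2\<close>. By Mills' ratio \<open>q'(u)\<close> and \<open>q''(u)\<close> are
  at most constant multiples of \<open>min u (1 - u)\<close> to the powers \<open>-1\<close> and \<open>-2\<close>, which yields the estimate
  already for \<open>B = 0\<close>.
\<close>

subsection \<open>Partial derivatives\<close>

lemma has_partial_deriv_iff:
  "has_partial_deriv i f x \<longleftrightarrow>
    ((\<lambda>h. f (x + h *\<^sub>R axis i 1)) has_real_derivative partial_deriv i f x) (at 0)"
  unfolding has_partial_deriv_def partial_deriv_def
  by (auto simp: DERIV_deriv_iff_real_differentiable real_differentiable_def)

lemma partial_derivI:
  assumes "((\<lambda>h. f (x + h *\<^sub>R axis i 1)) has_real_derivative D) (at 0)"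
  shows "has_partial_deriv i f x" "partial_deriv i f x = D"
  using assms unfolding has_partial_deriv_def partial_deriv_def
  by (auto simp: real_differentiable_def intro: DERIV_imp_deriv)

text \<open>\<open>has_partial_deriv\<close> speaks only of the parameter 0. Shifting it to an
  arbitrary parameter \<open>s\<close> makes the mean value theorem applicable along coordinate
  lines.\<close>

lemma has_partial_deriv_line:
  assumes "has_partial_deriv i f (x + s *\<^sub>R axis i 1)"
  shows "((\<lambda>h. f (x + h *\<^sub>R axis i 1)) has_real_derivative
    partial_deriv i f (x + s *\<^sub>R axis i 1)) (at s)"
proof -
  have "((\<lambda>h. f (x + (s + h) *\<^sub>R axis i 1)) has_real_derivative
      partial_deriv i f (x + s *\<^sub>R axis i 1)) (at 0)"
    using assms unfolding has_partial_deriv_iff by (simp add: scaleR_add_left add.assoc)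
  then have "((\<lambda>h. f (x + (h + s) *\<^sub>R axis i 1)) has_real_derivative
      partial_deriv i f (x + s *\<^sub>R axis i 1)) (at 0)"
    by (simp add: add.commute)
  then show ?thesis
    using DERIV_shift[of "\<lambda>h. f (x + h *\<^sub>R axis i 1)" _ 0 s] by simp
qed

text \<open>Partial derivatives are local, so identities known only on an open set, such as the unit
  cube, can still be differentiated there.\<close>

lemma partial_deriv_cong_open:
  assumes "open S" "x \<in> S" "\<And>y. y \<in> S \<Longrightarrow> f y = g y"
  shows "has_partial_deriv i f x \<longleftrightarrow> has_partial_deriv i g x"
    and "partial_deriv i f x = partial_deriv i g x"
proof -
  have "((\<lambda>h. x + h *\<^sub>R axis i 1) \<longlongrightarrow> x + 0 *\<^sub>R axis i 1) (nhds (0::real))"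
    by (intro tendsto_intros filterlim_ident)
  then have "eventually (\<lambda>h. x + h *\<^sub>R axis i 1 \<in> S) (nhds (0::real))"
    using assms(1,2) by (simp add: topological_tendstoD)
  then have ev: "eventually (\<lambda>h. f (x + h *\<^sub>R axis i 1) = g (x + h *\<^sub>R axis i 1)) (nhds 0)"
    by eventually_elim (use assms(3) in auto)
  then have D: "((\<lambda>h. f (x + h *\<^sub>R axis i 1)) has_real_derivative D) (at 0) \<longleftrightarrow>
      ((\<lambda>h. g (x + h *\<^sub>R axis i 1)) has_real_derivative D) (at 0)" for D
    by (intro DERIV_cong_ev) auto
  then show "has_partial_deriv i f x \<longleftrightarrow> has_partial_deriv i g x"
    unfolding has_partial_deriv_def real_differentiable_def by simp
  show "partial_deriv i f x = partial_deriv i g x"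
    unfolding partial_deriv_def deriv_def D ..
qed

section \<open>Symmetry of second partial derivatives\<close>

lemma double_increment_eq:
  assumes "0 < h"
    and S: "\<And>s t. s \<in> {0..h} \<Longrightarrow> t \<in> {0..h} \<Longrightarrow> x + s *\<^sub>R axis i 1 + t *\<^sub>R axis j 1 \<in> S"
    and f: "\<And>y. y \<in> S \<Longrightarrow> has_partial_deriv i f y"
    and fi: "\<And>y. y \<in> S \<Longrightarrow> has_partial_deriv j (partial_deriv i f) y"
  obtains s t where "s \<in> {0..h}" "t \<in> {0..h}"
    "f (x + h *\<^sub>R axis i 1 + h *\<^sub>R axis j 1) - f (x + h *\<^sub>R axis i 1) - f (x + h *\<^sub>R axis j 1) + f x
      = h\<^sup>2 * partial_deriv j (partial_deriv i f) (x + s *\<^sub>R axis i 1 + t *\<^sub>R axis j 1)"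
proof -
  \<comment> \<open>The second difference is the increment of \<open>?p\<close> over
    \<open>{0..h}\<close>. A mean value argument in direction \<open>i\<close> and another in
    direction \<open>j\<close> turn it into a single value of the mixed derivative.\<close>
  let ?p = "\<lambda>s. f ((x + h *\<^sub>R axis j 1) + s *\<^sub>R axis i 1) - f (x + s *\<^sub>R axis i 1)"
  let ?p' = "\<lambda>s. partial_deriv i f ((x + h *\<^sub>R axis j 1) + s *\<^sub>R axis i 1)
      - partial_deriv i f (x + s *\<^sub>R axis i 1)"
  have "(?p has_real_derivative ?p' s) (at s)" if "0 \<le> s" "s \<le> h" for s
    using S[of s h] S[of s 0] that \<open>0 < h\<close>
    by (intro DERIV_diff has_partial_deriv_line f) (auto simp: ac_simps)
  from MVT2[OF \<open>0 < h\<close> this] obtain s where s: "0 < s" "s < h" "?p h - ?p 0 = (h - 0) * ?p' s"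
    by blast
  let ?r = "\<lambda>t. partial_deriv i f ((x + s *\<^sub>R axis i 1) + t *\<^sub>R axis j 1)"
  have "(?r has_real_derivative
      partial_deriv j (partial_deriv i f) ((x + s *\<^sub>R axis i 1) + t *\<^sub>R axis j 1)) (at t)"
    if "0 \<le> t" "t \<le> h" for t
    using S[of s t] that s by (intro has_partial_deriv_line fi) auto
  from MVT2[OF \<open>0 < h\<close> this] obtain t where t: "0 < t" "t < h"
    "?r h - ?r 0 = (h - 0) * partial_deriv j (partial_deriv i f) ((x + s *\<^sub>R axis i 1) + t *\<^sub>R axis j 1)"
    by blast
  show ?thesis
    by (rule that[of s t]) (use s t in \<open>auto simp: ac_simps power2_eq_square\<close>)
qed

text \<open>The second difference over a small square does not depend on which direction comes
  first, so the two mixed derivatives take a common value, at possibly different points of the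
  square. Continuity carries this to the corner \<open>x\<close>.\<close>

lemma partial_deriv_commute:
  assumes S: "open S" "x \<in> S"
    and fi: "\<And>y. y \<in> S \<Longrightarrow> has_partial_deriv i f y"
    and fj: "\<And>y. y \<in> S \<Longrightarrow> has_partial_deriv j f y"
    and fij: "\<And>y. y \<in> S \<Longrightarrow> has_partial_deriv j (partial_deriv i f) y"
    and fji: "\<And>y. y \<in> S \<Longrightarrow> has_partial_deriv i (partial_deriv j f) y"
    and cij: "continuous_on S (partial_deriv j (partial_deriv i f))"
    and cji: "continuous_on S (partial_deriv i (partial_deriv j f))"
  shows "partial_deriv j (partial_deriv i f) x = partial_deriv i (partial_deriv j f) x"
proof (rule ccontr)
  let ?a = "partial_deriv j (partial_deriv i f)" and ?b = "partial_deriv i (partial_deriv j f)"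
  assume "?a x \<noteq> ?b x"
  \<comment> \<open>Half the gap: two errors below \<open>e\<close> cannot add up to it.\<close>
  define e where "e = \<bar>?a x - ?b x\<bar> / 2"
  have "e > 0" using \<open>?a x \<noteq> ?b x\<close> by (simp add: e_def)
  obtain r where r: "r > 0" "ball x r \<subseteq> S" using S openE by blast
  have "continuous (at x) ?a" "continuous (at x) ?b"
    using cij cji S by (auto simp: continuous_on_eq_continuous_at)
  then obtain d1 d2 where d: "d1 > 0" "d2 > 0"
    "\<And>y. dist y x < d1 \<Longrightarrow> dist (?a y) (?a x) < e" "\<And>y. dist y x < d2 \<Longrightarrow> dist (?b y) (?b x) < e"
    using \<open>e > 0\<close> unfolding continuous_at_eps_delta by metis
  \<comment> \<open>Points of the square are at distance at most \<open>2 * h\<close> from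
    \<open>x\<close>; taking a third of the radius keeps them strictly inside.\<close>
  define h where "h = min r (min d1 d2) / 3"
  have h: "h > 0" using r d by (simp add: h_def)
  have near: "dist (x + s *\<^sub>R axis k 1 + t *\<^sub>R axis l 1) x < min r (min d1 d2)"
    if "s \<in> {0..h}" "t \<in> {0..h}" for s t k l
  proof -
    have "norm (s *\<^sub>R axis k (1::real) + t *\<^sub>R axis l 1) \<le> \<bar>s\<bar> + \<bar>t\<bar>"
      by (rule order_trans[OF norm_triangle_ineq]) (simp add: norm_axis_1)
    also have "\<dots> < 3 * h" using that h by auto
    finally show ?thesis by (simp add: dist_norm h_def add.assoc)
  qed
  have inS: "x + s *\<^sub>R axis k 1 + t *\<^sub>R axis l 1 \<in> S" if "s \<in> {0..h}" "t \<in> {0..h}" for s t k l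
    using near[OF that] r by (auto simp: subset_iff dist_commute)
  obtain s t where st: "s \<in> {0..h}" "t \<in> {0..h}"
    "f (x + h *\<^sub>R axis i 1 + h *\<^sub>R axis j 1) - f (x + h *\<^sub>R axis i 1) - f (x + h *\<^sub>R axis j 1) + f x
      = h\<^sup>2 * ?a (x + s *\<^sub>R axis i 1 + t *\<^sub>R axis j 1)"
    using double_increment_eq[OF h inS fi fij] by metis
  obtain s' t' where st': "s' \<in> {0..h}" "t' \<in> {0..h}"
    "f (x + h *\<^sub>R axis j 1 + h *\<^sub>R axis i 1) - f (x + h *\<^sub>R axis j 1) - f (x + h *\<^sub>R axis i 1) + f x
      = h\<^sup>2 * ?b (x + s' *\<^sub>R axis j 1 + t' *\<^sub>R axis i 1)"
    using double_increment_eq[OF h inS fj fji] by metis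
  have "h\<^sup>2 * ?a (x + s *\<^sub>R axis i 1 + t *\<^sub>R axis j 1) = h\<^sup>2 * ?b (x + s' *\<^sub>R axis j 1 + t' *\<^sub>R axis i 1)"
    unfolding st(3)[symmetric] st'(3)[symmetric] by (simp add: algebra_simps)
  then have "?a (x + s *\<^sub>R axis i 1 + t *\<^sub>R axis j 1) = ?b (x + s' *\<^sub>R axis j 1 + t' *\<^sub>R axis i 1)"
    using h by simp
  moreover have "dist (?a (x + s *\<^sub>R axis i 1 + t *\<^sub>R axis j 1)) (?a x) < e"
    "dist (?b (x + s' *\<^sub>R axis j 1 + t' *\<^sub>R axis i 1)) (?b x) < e"
    using near st st' d by auto
  ultimately have "\<bar>?a x - ?b x\<bar> < e + e" unfolding dist_real_def by linarith
  then show False by (simp add: e_def)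
qed

section \<open>Total differentiability from continuous partial derivatives\<close>

lemma increment_partial_sum_le:
  fixes h :: "real^'d::finite \<Rightarrow> real"
  assumes h: "\<And>m z. has_partial_deriv m h z"
    and close: "\<And>m z. norm (z - x) < \<delta> \<Longrightarrow> \<bar>partial_deriv m h z - partial_deriv m h x\<bar> \<le> e"
    and y: "norm y < \<delta>"
  shows "\<bar>h (x + (\<Sum>m\<in>A. y $ m *\<^sub>R axis m 1)) - h x - (\<Sum>m\<in>A. partial_deriv m h x * y $ m)\<bar>
    \<le> e * (\<Sum>m\<in>A. \<bar>y $ m\<bar>)"
  using finite[of A]
proof (induction A)
  case (insert a A)
  \<comment> \<open>\<open>z\<close> is reached from \<open>x\<close> through the coordinates
    already treated; coordinate \<open>a\<close> adds a leg parallel to one axis. It is parametrized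
    over the unit interval because \<open>y $ a\<close> may be negative or zero.\<close>
  define z where "z = x + (\<Sum>m\<in>A. y $ m *\<^sub>R axis m 1)"
  have "((\<lambda>t. h (z + (t * y $ a) *\<^sub>R axis a 1)) has_real_derivative
      partial_deriv a h (z + (t * y $ a) *\<^sub>R axis a 1) * (y $ a)) (at t)" for t
    by (rule DERIV_chain2[where f = "\<lambda>s. h (z + s *\<^sub>R axis a 1)" and g = "\<lambda>t. t * y $ a",
          OF has_partial_deriv_line[OF h]]) (auto intro!: derivative_eq_intros)
  from MVT2[OF zero_less_one this] obtain t where t: "0 < t" "t < 1"
    "h (z + (1 * y $ a) *\<^sub>R axis a 1) - h (z + (0 * y $ a) *\<^sub>R axis a 1) =
      (1 - 0) * (partial_deriv a h (z + (t * y $ a) *\<^sub>R axis a 1) * (y $ a))"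
    by blast
  let ?w = "z + (t * y $ a) *\<^sub>R axis a 1"
  \<comment> \<open>No component of \<open>?w - x\<close> exceeds that of \<open>y\<close> in
    absolute value, so \<open>?w\<close> stays where the partial derivatives are close to those at
    \<open>x\<close>.\<close>
  have "(?w - x) $ k = (if k \<in> A then y $ k else if k = a then t * y $ a else 0)" for k
  proof -
    have "(\<Sum>m\<in>A. y $ m * axis m 1 $ k) = (\<Sum>m\<in>A. if m = k then y $ k else 0)"
      by (intro sum.cong) (auto simp: axis_def)
    then show ?thesis
      using insert(2) by (auto simp: z_def axis_def sum.delta)
  qed
  then have "\<bar>(?w - x) $ k\<bar> \<le> \<bar>y $ k\<bar>" for k
    using t by (auto simp: abs_mult intro: mult_left_le_one_le)
  then have "norm (?w - x) \<le> norm y"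
    by (intro norm_le_componentwise_cart) auto
  then have "\<bar>partial_deriv a h ?w - partial_deriv a h x\<bar> \<le> e" using close y by simp
  then have "\<bar>partial_deriv a h ?w - partial_deriv a h x\<bar> * \<bar>y $ a\<bar> \<le> e * \<bar>y $ a\<bar>"
    by (intro mult_right_mono) auto
  then have "\<bar>h (z + y $ a *\<^sub>R axis a 1) - h z - partial_deriv a h x * y $ a\<bar> \<le> e * \<bar>y $ a\<bar>"
    using t(3) by (simp add: left_diff_distrib[symmetric] abs_mult[symmetric])
  moreover have eq: "x + (\<Sum>m\<in>insert a A. y $ m *\<^sub>R axis m 1) = z + y $ a *\<^sub>R axis a 1"
    using insert by (simp add: z_def)
  ultimately show ?case
    unfolding eq using insert by (simp add: z_def[symmetric] distrib_left)
qed auto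

lemma has_derivative_continuous_partials:
  fixes h :: "real^'d::finite \<Rightarrow> real"
  assumes h: "\<And>m z. has_partial_deriv m h z"
    and cont: "\<And>m. continuous (at x) (partial_deriv m h)"
  shows "(h has_derivative (\<lambda>y. \<Sum>m\<in>UNIV. partial_deriv m h x * y $ m)) (at x)"
  unfolding has_derivative_at_alt
proof (intro conjI allI impI)
  show "bounded_linear (\<lambda>y. \<Sum>m\<in>UNIV. partial_deriv m h x * y $ m)"
    by (intro bounded_linear_sum bounded_linear_const_mult bounded_linear_vec_nth)
next
  fix e :: real assume "e > 0"
  \<comment> \<open>The sum of the absolute components is at most \<open>CARD('d)\<close> times the
    norm, hence the division.\<close>
  define e' where "e' = e / CARD('d)"
  have "e' > 0" using \<open>e > 0\<close> by (simp add: e'_def)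
  then have "\<exists>d>0. \<forall>z. norm (z - x) < d \<longrightarrow> \<bar>partial_deriv m h z - partial_deriv m h x\<bar> < e'" for m
    using cont[of m] unfolding continuous_at_eps_delta dist_norm real_norm_def by blast
  then obtain d where d: "\<And>m. d m > 0"
    "\<And>m z. norm (z - x) < d m \<Longrightarrow> \<bar>partial_deriv m h z - partial_deriv m h x\<bar> < e'"
    by metis
  show "\<exists>\<delta>>0. \<forall>z. norm (z - x) < \<delta> \<longrightarrow>
    norm (h z - h x - (\<Sum>m\<in>UNIV. partial_deriv m h x * (z - x) $ m)) \<le> e * norm (z - x)"
  proof (intro exI[of _ "Min (range d)"] conjI allI impI)
    fix z assume z: "norm (z - x) < Min (range d)"
    have "x + (\<Sum>m\<in>UNIV. (z - x) $ m *\<^sub>R axis m 1) = z"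
      using basis_expansion[of "z - x"] by (simp add: scalar_mult_eq_scaleR)
    with increment_partial_sum_le[OF h, of x "Min (range d)" e' "z - x" UNIV] z d
    have "norm (h z - h x - (\<Sum>m\<in>UNIV. partial_deriv m h x * (z - x) $ m))
        \<le> e' * (\<Sum>m\<in>UNIV. \<bar>(z - x) $ m\<bar>)"
      by (force simp: less_imp_le)
    also have "\<dots> \<le> e' * (\<Sum>m\<in>(UNIV::'d set). norm (z - x))"
      using \<open>e' > 0\<close> by (intro mult_left_mono sum_mono component_le_norm_cart) auto
    also have "\<dots> = e * norm (z - x)" by (simp add: e'_def)
    finally show "norm (h z - h x - (\<Sum>m\<in>UNIV. partial_deriv m h x * (z - x) $ m)) \<le> e * norm (z - x)" .
  qed (use d in auto)
qed

subsection \<open>Functions with bounded derivatives\<close>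

text \<open>
  With \<open>A\<close> the continuous functions on \<open>S\<close> this is \<open>Ck_on\<close>; with \<open>A\<close> the bounded continuous
  functions it also bounds all derivatives up to order \<open>k\<close>.
\<close>

primrec Ck_in :: "(real^'d::finite \<Rightarrow> real) set \<Rightarrow> nat \<Rightarrow> (real^'d) set \<Rightarrow> (real^'d \<Rightarrow> real) \<Rightarrow> bool" where
  "Ck_in A 0 S f \<longleftrightarrow> f \<in> A"
| "Ck_in A (Suc k) S f \<longleftrightarrow>
     f \<in> A \<and> (\<forall>i. (\<forall>x\<in>S. has_partial_deriv i f x) \<and> Ck_in A k S (partial_deriv i f))"

lemma Ck_in_imp_mem: "Ck_in A k S f \<Longrightarrow> f \<in> A"
  by (cases k) auto

lemma Ck_in_mono: "Ck_in A l S f \<Longrightarrow> k \<le> l \<Longrightarrow> Ck_in A k S f"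
proof (induction k arbitrary: f l)
  case 0
  then show ?case using Ck_in_imp_mem by auto
next
  case (Suc k)
  then obtain l' where "l = Suc l'" by (cases l) auto
  with Suc show ?case by auto
qed

text \<open>Induction from the end of the list: \<open>foldr\<close> applies the last entry first,
  and this innermost derivative is the one that \<open>Ck_in\<close> peels off.\<close>

lemma Ck_in_iterated: "Ck_in A (n + length is) S f \<Longrightarrow> Ck_in A n S (foldr partial_deriv is f)"
  by (induction "is" arbitrary: f rule: rev_induct) auto

lemma Ck_on_eq_Ck_in: "Ck_on k S f = Ck_in {f. continuous_on S f} k S f"
  by (induction k arbitrary: f) auto

section \<open>Rules of differentiation, and closure of the smoothness classes under sums and
  products\<close>

lemma partial_deriv_add:
  assumes "has_partial_deriv i f x" "has_partial_deriv i g x"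
  shows "has_partial_deriv i (\<lambda>x. f x + g x) x"
    and "partial_deriv i (\<lambda>x. f x + g x) x = partial_deriv i f x + partial_deriv i g x"
  using partial_derivI[of "\<lambda>x. f x + g x", OF DERIV_add] assms
  unfolding has_partial_deriv_iff by blast+

lemma partial_deriv_mult:
  assumes "has_partial_deriv i f x" "has_partial_deriv i g x"
  shows "has_partial_deriv i (\<lambda>x. f x * g x) x"
    and "partial_deriv i (\<lambda>x. f x * g x) x = partial_deriv i f x * g x + f x * partial_deriv i g x"
proof -
  have "((\<lambda>h. f (x + h *\<^sub>R axis i 1) * g (x + h *\<^sub>R axis i 1)) has_real_derivative
      partial_deriv i f x * g x + f x * partial_deriv i g x) (at 0)"
    using assms unfolding has_partial_deriv_iff
    by (auto intro!: derivative_eq_intros)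
  from partial_derivI[of "\<lambda>x. f x * g x", OF this] show "has_partial_deriv i (\<lambda>x. f x * g x) x"
    "partial_deriv i (\<lambda>x. f x * g x) x = partial_deriv i f x * g x + f x * partial_deriv i g x"
    by auto
qed

lemma partial_deriv_const [simp]: "has_partial_deriv i (\<lambda>_. c) x" "partial_deriv i (\<lambda>_. c) = (\<lambda>_. 0)"
  using partial_derivI[of "\<lambda>_. c", OF DERIV_const] by blast+

lemma partial_deriv_component:
  fixes i j :: "'d::finite"
  shows "has_partial_deriv i (\<lambda>x. x $ j) x"
    and "partial_deriv i (\<lambda>x. x $ j) = (\<lambda>_. if i = j then 1 else 0)"
proof -
  have "((\<lambda>h. (x + h *\<^sub>R axis i 1) $ j) has_real_derivative (if i = j then 1 else 0)) (at 0)" for x :: "real^'d"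
    by (auto intro!: derivative_eq_intros simp: axis_def)
  from partial_derivI[of "\<lambda>x. x $ j", OF this]
  show "has_partial_deriv i (\<lambda>x. x $ j) x" "partial_deriv i (\<lambda>x. x $ j) = (\<lambda>_. if i = j then 1 else 0)"
    by blast+
qed

text \<open>Treats at once both classes that occur: continuous functions on an open set and bounded
  continuous functions on the whole space. Membership must be invariant under changes off
  \<open>S\<close>, because the differentiation rules are known only on \<open>S\<close>.\<close>

locale function_algebra =
  fixes S :: "(real^'d::finite) set" and A :: "(real^'d \<Rightarrow> real) set"
  assumes open_dom: "open S"
    and const_mem: "(\<lambda>_. c) \<in> A"
    and add_mem: "f \<in> A \<Longrightarrow> g \<in> A \<Longrightarrow> (\<lambda>x. f x + g x) \<in> A"
    and mult_mem: "f \<in> A \<Longrightarrow> g \<in> A \<Longrightarrow> (\<lambda>x. f x * g x) \<in> A"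
    and cong_mem: "f \<in> A \<Longrightarrow> (\<And>x. x \<in> S \<Longrightarrow> f x = g x) \<Longrightarrow> g \<in> A"
begin

lemma Ck_in_cong: "Ck_in A k S f \<Longrightarrow> (\<And>x. x \<in> S \<Longrightarrow> f x = g x) \<Longrightarrow> Ck_in A k S g"
proof (induction k arbitrary: f g)
  case 0
  then show ?case using cong_mem by simp
next
  case (Suc k)
  then have fg: "f \<in> A" "\<And>x. x \<in> S \<Longrightarrow> f x = g x" by auto
  note pd = partial_deriv_cong_open[where f = f and g = g, OF open_dom _ fg(2)]
  have "has_partial_deriv i g x" if "x \<in> S" for i x
    using pd(1)[OF that] Suc.prems that by auto
  moreover have "Ck_in A k S (partial_deriv i g)" for i
    by (rule Suc.IH[of "partial_deriv i f"]) (use pd(2) Suc.prems in auto)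
  ultimately show ?case using cong_mem[OF fg] by auto
qed

lemma Ck_in_const: "Ck_in A k S (\<lambda>_. c)"
  by (induction k arbitrary: c) (auto simp: const_mem)

lemma Ck_in_add: "Ck_in A k S f \<Longrightarrow> Ck_in A k S g \<Longrightarrow> Ck_in A k S (\<lambda>x. f x + g x)"
proof (induction k arbitrary: f g)
  case 0
  then show ?case using add_mem by simp
next
  case (Suc k)
  have "Ck_in A k S (partial_deriv i (\<lambda>x. f x + g x))" for i
    by (rule Ck_in_cong[OF Suc.IH[of "partial_deriv i f" "partial_deriv i g"]])
      (use Suc.prems in \<open>auto simp: partial_deriv_add\<close>)
  then show ?case using Suc.prems by (auto simp: add_mem partial_deriv_add)
qed

lemma Ck_in_mult: "Ck_in A k S f \<Longrightarrow> Ck_in A k S g \<Longrightarrow> Ck_in A k S (\<lambda>x. f x * g x)"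
proof (induction k arbitrary: f g)
  case 0
  then show ?case using mult_mem by simp
next
  case (Suc k)
  \<comment> \<open>The product rule leaves one factor undifferentiated, so each factor is needed at
    the lower order \<open>k\<close> too.\<close>
  then have fg: "Ck_in A k S f" "Ck_in A k S g"
    using Ck_in_mono[OF Suc.prems(1)] Ck_in_mono[OF Suc.prems(2)] by auto
  have "Ck_in A k S (partial_deriv i (\<lambda>x. f x * g x))" for i
    by (rule Ck_in_cong[OF Ck_in_add[OF Suc.IH[of "partial_deriv i f" g] Suc.IH[of f "partial_deriv i g"]]])
      (use fg Suc.prems in \<open>auto simp: partial_deriv_mult\<close>)
  then show ?case using Suc.prems by (auto simp: mult_mem partial_deriv_mult)
qed

lemma Ck_in_sum: "(\<And>m. m \<in> M \<Longrightarrow> Ck_in A k S (f m)) \<Longrightarrow> Ck_in A k S (\<lambda>x. \<Sum>m\<in>M. f m x)"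
  by (induction M rule: infinite_finite_induct) (auto intro: Ck_in_add Ck_in_const)

end

lemma function_algebra_continuous:
  "open S \<Longrightarrow> function_algebra S {f. continuous_on S f}"
  by unfold_locales (auto intro!: continuous_intros cong: continuous_on_cong)

abbreviation bounded_continuous :: "('a::topological_space \<Rightarrow> real) set" where
  "bounded_continuous \<equiv> {f. continuous_on UNIV f \<and> bounded (range f)}"

interpretation bounded_alg: function_algebra UNIV "bounded_continuous :: (real^'d::finite \<Rightarrow> real) set"
proof unfold_locales
  fix f g :: "real^'d \<Rightarrow> real"
  assume "f \<in> bounded_continuous" "g \<in> bounded_continuous"
  then obtain M N where MN: "\<And>x. \<bar>f x\<bar> \<le> M" "\<And>x. \<bar>g x\<bar> \<le> N" and
    cont: "continuous_on UNIV f" "continuous_on UNIV g"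
    by (auto simp: bounded_iff)
  have "\<bar>f x + g x\<bar> \<le> M + N" for x using MN[of x] by linarith
  then show "(\<lambda>x. f x + g x) \<in> bounded_continuous"
    using cont by (auto intro!: continuous_intros simp: bounded_iff)
  have "\<bar>f x * g x\<bar> \<le> M * N" for x
    unfolding abs_mult using MN[of x] by (intro mult_mono) auto
  then show "(\<lambda>x. f x * g x) \<in> bounded_continuous"
    using cont by (auto intro!: continuous_intros simp: bounded_iff)
next
  fix f g :: "real^'d \<Rightarrow> real"
  assume "f \<in> bounded_continuous" "\<And>x. x \<in> UNIV \<Longrightarrow> f x = g x"
  moreover from this have "f = g" by auto
  ultimately show "g \<in> bounded_continuous" by simp
qed auto

lemma Ck_in_boundedI:
  "Ck_on k UNIV f \<Longrightarrow> (\<And>is. length is \<le> k \<Longrightarrow> bounded (range (foldr partial_deriv is f))) \<Longrightarrow>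
    Ck_in bounded_continuous k UNIV f"
proof (induction k arbitrary: f)
  case (Suc k)
  have "Ck_in bounded_continuous k UNIV (partial_deriv i f)" for i
  proof (rule Suc.IH)
    show "bounded (range (foldr partial_deriv is (partial_deriv i f)))" if "length is \<le> k" for "is"
      using Suc.prems(2)[of "is @ [i]"] that by simp
  qed (use Suc.prems in auto)
  then show ?case using Suc.prems Suc.prems(2)[of "[]"] by auto
qed (auto dest: spec[of _ "[]"])

lemma Ck_in_bounded_iterated:
  assumes "Ck_in bounded_continuous k UNIV f" "length is \<le> k"
  obtains M where "\<And>x. \<bar>foldr partial_deriv is f x\<bar> \<le> M"
proof -
  have "Ck_in bounded_continuous (0 + length is) UNIV f"
    using Ck_in_mono[OF assms] by simp
  from Ck_in_iterated[OF this] show ?thesis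
    using that by (auto simp: bounded_iff)
qed

lemma Ck_in_bounded_imp_Ck_on:
  "Ck_in bounded_continuous k UNIV f \<Longrightarrow> Ck_on k UNIV f"
  by (induction k arbitrary: f) auto

section \<open>Chain rule\<close>

lemma partial_deriv_compose:
  fixes h :: "real^'m::finite \<Rightarrow> real" and X :: "real^'d::finite \<Rightarrow> real^'m"
  assumes h: "\<And>m z. has_partial_deriv m h z"
    and cont: "\<And>m. continuous (at (X x)) (partial_deriv m h)"
    and X: "\<And>m. has_partial_deriv i (\<lambda>x. X x $ m) x"
  shows "has_partial_deriv i (\<lambda>x. h (X x)) x"
    and "partial_deriv i (\<lambda>x. h (X x)) x
      = (\<Sum>m\<in>UNIV. partial_deriv m h (X x) * partial_deriv i (\<lambda>x. X x $ m) x)"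
proof -
  let ?D = "\<chi> m. partial_deriv i (\<lambda>x. X x $ m) x"
  \<comment> \<open>Along the line in direction \<open>i\<close> the inner map is a differentiable
    curve, since each component is. The outer function needs a total derivative, which its
    continuous partial derivatives provide.\<close>
  have "((\<lambda>t. X (x + t *\<^sub>R axis i 1)) has_derivative (\<lambda>t. t *\<^sub>R ?D)) (at 0)"
    unfolding has_derivative_componentwise_within[of _ "\<lambda>t. t *\<^sub>R ?D"] Basis_vec_def
    using X by (auto simp: inner_axis has_partial_deriv_iff has_field_derivative_def mult_commute_abs)
  moreover have "(h has_derivative (\<lambda>y. \<Sum>m\<in>UNIV. partial_deriv m h (X x) * y $ m))
      (at (X (x + 0 *\<^sub>R axis i 1)))"
    using has_derivative_continuous_partials[OF h cont] by simp
  ultimately have "((\<lambda>t. h (X (x + t *\<^sub>R axis i 1))) has_derivative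
      (\<lambda>t. \<Sum>m\<in>UNIV. partial_deriv m h (X x) * (t *\<^sub>R ?D) $ m)) (at 0)"
    by (rule diff_chain_at[of "\<lambda>t. X (x + t *\<^sub>R axis i 1)", unfolded o_def])
  then have "((\<lambda>t. h (X (x + t *\<^sub>R axis i 1))) has_real_derivative
      (\<Sum>m\<in>UNIV. partial_deriv m h (X x) * partial_deriv i (\<lambda>x. X x $ m) x)) (at 0)"
    unfolding has_field_derivative_def
    by (rule has_derivative_eq_rhs) (auto simp: sum_distrib_left ac_simps intro!: ext)
  from partial_derivI[of "\<lambda>x. h (X x)", OF this] show "has_partial_deriv i (\<lambda>x. h (X x)) x"
    "partial_deriv i (\<lambda>x. h (X x)) x
      = (\<Sum>m\<in>UNIV. partial_deriv m h (X x) * partial_deriv i (\<lambda>x. X x $ m) x)"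
    by auto
qed

text \<open>Only first partial derivatives of \<open>X\<close> lie in the bounded class, because the
  intended \<open>X\<close> is an Euler iterate, the identity plus a bounded function. In
  derivatives of \<open>h (X x)\<close> the map \<open>X\<close> itself occurs only as an argument
  of bounded functions. One derivative of \<open>X\<close> is split off, so \<open>k\<close> may
  reach \<open>Suc n\<close>.\<close>

lemma Ck_in_bounded_compose:
  fixes h :: "real^'m::finite \<Rightarrow> real" and X :: "real^'d::finite \<Rightarrow> real^'m"
  assumes X: "continuous_on UNIV X" "\<And>m i x. has_partial_deriv i (\<lambda>x. X x $ m) x"
    "\<And>m i. Ck_in bounded_continuous n UNIV (partial_deriv i (\<lambda>x. X x $ m))"
  shows "k \<le> Suc n \<Longrightarrow> Ck_in bounded_continuous k UNIV h \<Longrightarrow>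
    Ck_in bounded_continuous k UNIV (\<lambda>x. h (X x))"
proof (induction k arbitrary: h)
  case 0
  then show ?case
    by (auto simp: bounded_iff intro: continuous_on_compose2[OF _ X(1)])
next
  case (Suc k)
  then have h: "has_partial_deriv m h z" "Ck_in bounded_continuous k UNIV (partial_deriv m h)" for m z
    by auto
  have cont: "continuous (at z) (partial_deriv m h)" for m z
    using Ck_in_imp_mem[OF h(2)] by (auto simp: continuous_on_eq_continuous_at)
  note pd = partial_deriv_compose[OF h(1) cont X(2)]
  have "Ck_in bounded_continuous k UNIV (partial_deriv i (\<lambda>x. h (X x)))" for i
    unfolding ext[of "partial_deriv i (\<lambda>x. h (X x))", OF pd(2)]
    by (intro bounded_alg.Ck_in_sum bounded_alg.Ck_in_mult Suc.IH h Ck_in_mono[OF X(3)])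
      (use Suc.prems in auto)
  moreover have "(\<lambda>x. h (X x)) \<in> bounded_continuous"
    using Suc.prems by (auto simp: bounded_iff intro: continuous_on_compose2[OF _ X(1)])
  ultimately show ?case using pd(1) by simp
qed

section \<open>Independence of the order of differentiation\<close>

lemma Ck_on_mono: "Ck_on l S f \<Longrightarrow> k \<le> l \<Longrightarrow> Ck_on k S f"
  unfolding Ck_on_eq_Ck_in by (rule Ck_in_mono)

lemma Ck_on_iterated: "Ck_on (n + length is) S f \<Longrightarrow> Ck_on n S (foldr partial_deriv is f)"
  unfolding Ck_on_eq_Ck_in by (rule Ck_in_iterated)

lemma iterated_partial_swap:
  assumes "open S" "x \<in> S" "Ck_on (length is + 2) S f"
  shows "foldr partial_deriv (a # b # is) f x = foldr partial_deriv (b # a # is) f x"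
proof -
  have "Ck_on 2 S (foldr partial_deriv is f)"
    using Ck_on_iterated[of 2 "is" S f] assms(3) by (simp only: add.commute)
  then show ?thesis
    using assms(1,2) by (auto simp: numeral_2_eq_2 intro!: partial_deriv_commute[of S])
qed

text \<open>Neighbouring derivatives are exchanged until \<open>a\<close> is outermost. The point
  \<open>y\<close> is arbitrary in the induction because the identity for the tail is differentiated
  once more and so must hold on all of \<open>S\<close>.\<close>

lemma iterated_partial_move:
  assumes "open S" "y \<in> S" "a \<in> set is" "Ck_on (length is) S f"
  shows "foldr partial_deriv is f y = foldr partial_deriv (a # remove1 a is) f y"
  using assms(2-4)
proof (induction "is" arbitrary: y)
  case (Cons b "is")
  show ?case
  proof (cases "a = b")
    case False
    then have a: "a \<in> set is" using Cons.prems by auto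
    have "foldr partial_deriv (b # is) f y = partial_deriv b (foldr partial_deriv (a # remove1 a is) f) y"
      unfolding foldr.simps o_def
      by (rule partial_deriv_cong_open(2)[OF assms(1) Cons.prems(1)])
        (use Cons.IH[OF _ a] Ck_on_mono[OF Cons.prems(3), of "length is"] in \<open>auto simp: o_def\<close>)
    also have "\<dots> = foldr partial_deriv (a # b # remove1 a is) f y"
    proof -
      have "length (remove1 a is) + 2 \<le> length (b # is)"
        using a length_pos_if_in_set[OF a] by (simp add: length_remove1)
      then have "Ck_on (length (remove1 a is) + 2) S f"
        by (rule Ck_on_mono[OF Cons.prems(3)])
      from iterated_partial_swap[OF assms(1) Cons.prems(1) this, of b a] show ?thesis
        by simp
    qed
    finally show ?thesis using False by simp
  qed simp
qed simp

text \<open>The head of the first list is moved to the front of the second; the remaining lists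
  again have equal multisets.\<close>

lemma iterated_partial_mset:
  assumes "open S" "y \<in> S" "mset is = mset js" "Ck_on (length is) S f"
  shows "foldr partial_deriv is f y = foldr partial_deriv js f y"
  using assms(2-4)
proof (induction "is" arbitrary: y js)
  case (Cons a "is")
  then have a: "a \<in> set js" by (metis list.set_intros(1) mset_eq_setD)
  have len: "length (a # is) = length js" using Cons.prems(2) by (rule mset_eq_length)
  have "mset is = mset (remove1 a js)" using Cons.prems(2) by (metis add_mset_remove_trivial mset.simps(2) mset_remove1)
  then have "foldr partial_deriv (a # is) f y = foldr partial_deriv (a # remove1 a js) f y"
    unfolding foldr.simps o_def
    by (intro partial_deriv_cong_open(2)[OF assms(1) Cons.prems(1)] Cons.IH)
      (use Ck_on_mono[OF Cons.prems(3), of "length is"] in auto)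
  also have "\<dots> = foldr partial_deriv js f y"
    using iterated_partial_move[OF assms(1) Cons.prems(1) a, of f] Cons.prems(3) len by metis
  finally show ?case .
qed simp

text \<open>Replaces the arbitrary sequence chosen in \<open>mixed_partial\<close> by any convenient
  one with the same counts.\<close>

lemma mixed_partial_eq:
  assumes "open S" "y \<in> S" "\<And>i. count_list is i = \<beta> i" "Ck_on (length is) S f"
  shows "mixed_partial \<beta> f y = foldr partial_deriv is f y"
proof -
  have "\<forall>i. count_list (SOME is. \<forall>i. count_list is i = \<beta> i) i = \<beta> i"
    by (rule someI_ex) (use assms(3) in blast)
  then have "mset is = mset (SOME is. \<forall>i. count_list is i = \<beta> i)"
    using assms(3) by (intro multiset_eqI) (simp add: count_mset)
  from iterated_partial_mset[OF assms(1,2) this assms(4)] show ?thesis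
    by (simp add: mixed_partial_def)
qed

text \<open>A multi-index bounds only one chosen order of differentiation; symmetry extends the
  bound to every sequence, as \<open>Ck_in\<close> demands.\<close>

lemma Ck_in_bounded_if_mixed_partials_bounded:
  fixes f :: "real^'d::finite \<Rightarrow> real"
  assumes "Ck_on k UNIV f"
    and "\<And>\<beta>. (\<Sum>i\<in>UNIV. \<beta> i) \<le> k \<Longrightarrow> bounded (range (mixed_partial \<beta> f))"
  shows "Ck_in bounded_continuous k UNIV f"
proof (rule Ck_in_boundedI[OF assms(1)])
  fix "is" :: "'d list" assume "is": "length is \<le> k"
  have "mixed_partial (count_list is) f = foldr partial_deriv is f"
    using Ck_on_mono[OF assms(1) "is"] by (intro ext mixed_partial_eq[of UNIV]) auto
  then show "bounded (range (foldr partial_deriv is f))"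
    using assms(2)[of "count_list is"] "is" by (simp add: sum_count_set)
qed

subsection \<open>The normal quantile\<close>

text \<open>Anchored at a finite point \<open>a\<close>, so that the fundamental theorem of calculus
  on compact intervals yields the density as derivative. Closing the half-open interval adds only
  the null set \<open>{a}\<close>.\<close>

lemma std_normal_cdf_diff:
  assumes "a \<le> y"
  shows "std_normal_cdf y - std_normal_cdf a = integral {a..y} std_normal_density"
proof (cases "a = y")
  case False
  interpret real_distribution std_normal_distribution by (rule real_dist_normal_dist)
  have int: "set_integrable lborel {a<..y} std_normal_density"
    unfolding set_integrable_def by (intro integrable_mult_indicator) auto
  have "std_normal_cdf y - std_normal_cdf a = measure std_normal_distribution {a<..y}"
    unfolding std_normal_cdf_def using False assms by (intro cdf_diff_eq) auto
  also have "\<dots> = (\<integral>x. indicator {a<..y} x \<partial>std_normal_distribution)" by simp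
  also have "\<dots> = (\<integral>x. std_normal_density x * indicator {a<..y} x \<partial>lborel)"
    by (subst integral_real_density) auto
  also have "\<dots> = integral {a<..y} std_normal_density"
    using set_borel_integral_eq_integral(2)[OF int]
    by (simp add: set_lebesgue_integral_def mult.commute)
  also have "\<dots> = integral {a..y} std_normal_density"
    by (rule integral_subset_negligible) (auto intro: negligible_subset[of "{a}"])
  finally show ?thesis .
qed simp

lemma DERIV_std_normal_density:
  "(std_normal_density has_real_derivative - x * std_normal_density x) (at x)"
proof -
  have "((\<lambda>x. 1 / sqrt (2 * pi) * exp (- x\<^sup>2 / 2)) has_real_derivative
      1 / sqrt (2 * pi) * (exp (- x\<^sup>2 / 2) * - x)) (at x)"
    by (intro DERIV_cmult) (auto intro!: derivative_eq_intros)
  then show ?thesis unfolding std_normal_density_def[abs_def] by (simp add: ac_simps)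
qed

lemma DERIV_std_normal_cdf: "(std_normal_cdf has_real_derivative std_normal_density x) (at x)"
proof -
  \<comment> \<open>Starting the integral at \<open>x - 1\<close> puts \<open>x\<close> in the
    interior of \<open>{x - 1..x + 1}\<close>, where the derivative within the interval is the full
    derivative.\<close>
  have "((\<lambda>y. std_normal_cdf (x - 1) + integral {x - 1..y} std_normal_density) has_real_derivative
      0 + std_normal_density x) (at x within {x - 1..x + 1})"
    by (intro derivative_intros integral_has_real_derivative DERIV_continuous_on[OF
        has_field_derivative_at_within[OF DERIV_std_normal_density]]) auto
  then have "((\<lambda>y. std_normal_cdf (x - 1) + integral {x - 1..y} std_normal_density) has_real_derivative
      std_normal_density x) (at x)"
    using at_within_Icc_at[of "x - 1" x "x + 1"] by simp
  then show ?thesis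
    by (rule has_field_derivative_transform_within_open[of _ _ _ "{x - 1<..<x + 1}"])
      (auto simp flip: std_normal_cdf_diff)
qed

lemma std_normal_cdf_strict_mono: "strict_mono std_normal_cdf"
  by (intro strict_monoI DERIV_pos_imp_increasing[of _ _ std_normal_cdf])
    (auto intro!: exI[of _ "std_normal_density _"] DERIV_std_normal_cdf normal_density_pos)

lemma isCont_std_normal_cdf: "isCont std_normal_cdf x"
  using DERIV_isCont[OF DERIV_std_normal_cdf] .

lemma std_normal_cdf_lims:
  "(std_normal_cdf \<longlongrightarrow> 1) at_top" "(std_normal_cdf \<longlongrightarrow> 0) at_bot"
  unfolding std_normal_cdf_def
  using real_distribution.axioms(1)[OF real_dist_normal_dist] real_dist_normal_dist
  by (auto intro: real_distribution.cdf_lim_at_top_prob finite_borel_measure.cdf_lim_at_bot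
      real_distribution.finite_borel_measure_M)

abbreviation std_normal_quantile :: "real \<Rightarrow> real" where
  "std_normal_quantile \<equiv> inv std_normal_cdf"

lemma quantile_cdf [simp]: "std_normal_quantile (std_normal_cdf x) = x"
  using std_normal_cdf_strict_mono by (simp add: strict_mono_imp_inj_on)

text \<open>By its limits and the intermediate value theorem the distribution function attains every
  value in the open unit interval, which makes \<open>inv\<close> a right inverse there.\<close>

lemma cdf_quantile:
  assumes "0 < u" "u < 1"
  shows "std_normal_cdf (std_normal_quantile u) = u"
proof -
  obtain a where a: "std_normal_cdf a < u"
    using order_tendstoD(2)[OF std_normal_cdf_lims(2) assms(1)] by (auto simp: eventually_at_bot_linorder)
  obtain b where b: "u < std_normal_cdf b"
    using order_tendstoD(1)[OF std_normal_cdf_lims(1) assms(2)] by (auto simp: eventually_at_top_linorder)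
  have "a \<le> b" using a b strict_mono_less_eq[OF std_normal_cdf_strict_mono, of a b] by simp
  then obtain x where "std_normal_cdf x = u"
    using IVT[of std_normal_cdf a u b] a b isCont_std_normal_cdf by auto
  then show ?thesis by auto
qed

lemma DERIV_quantile:
  assumes "0 < u" "u < 1"
  shows "(std_normal_quantile has_real_derivative
    1 / std_normal_density (std_normal_quantile u)) (at u)"
proof -
  have "isCont std_normal_quantile (std_normal_cdf (std_normal_quantile u))"
    by (rule isCont_inverse_function[of 1]) (auto intro: isCont_std_normal_cdf)
  then have "isCont std_normal_quantile u" by (simp add: cdf_quantile assms)
  then have "(std_normal_quantile has_real_derivative
      inverse (std_normal_density (std_normal_quantile u))) (at u)"
    using assms DERIV_std_normal_cdf cdf_quantile
    by (intro DERIV_inverse_function[of std_normal_cdf _ _ _ 0 1])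
      (auto simp: less_imp_neq[OF normal_density_pos, symmetric])
  then show ?thesis by (simp add: inverse_eq_divide)
qed

text \<open>Mills' ratio: the difference of the two sides is monotone in the tail and vanishes at infinity.\<close>

lemma upper_tail_le_density:
  assumes "0 < x"
  shows "x * (1 - std_normal_cdf x) \<le> std_normal_density x"
proof -
  \<comment> \<open>The denominator is the fixed \<open>x\<close>, not \<open>t\<close>: the
    derivative is then the density times \<open>1 - t / x\<close>, which is nonpositive for
    \<open>t \<ge> x\<close>.\<close>
  define E where "E t = std_normal_density t / x - (1 - std_normal_cdf t)" for t
  have "(E has_real_derivative std_normal_density t * (1 - t / x)) (at t)" for t
    unfolding E_def using assms
    by (auto intro!: derivative_eq_intros DERIV_std_normal_density DERIV_std_normal_cdf simp: field_simps)
  moreover have "std_normal_density t * (1 - t / x) \<le> 0" if "x \<le> t" for t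
    using that assms by (intro mult_nonneg_nonpos) (auto simp: field_simps)
  ultimately have "E t \<le> E x" if "x \<le> t" for t
    using that by (intro DERIV_nonpos_imp_nonincreasing[of x t E]) auto
  moreover have "(E \<longlongrightarrow> 0 / x - (1 - 1)) at_top"
    unfolding E_def
  proof (intro tendsto_intros std_normal_cdf_lims)
    show "(std_normal_density \<longlongrightarrow> 0) at_top"
      unfolding std_normal_density_def[abs_def] by real_asymp
  qed (use assms in auto)
  ultimately have "0 \<le> E x"
    by (intro tendsto_upperbound[of E 0 at_top]) (auto simp: eventually_at_top_linorder)
  then show ?thesis using assms by (simp add: E_def field_simps)
qed

text \<open>Mirror image of the upper tail: \<open>E\<close> is nondecreasing up to \<open>x\<close>
  and starts from the limit 0 at minus infinity.\<close>

lemma lower_tail_le_density: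
  assumes "x < 0"
  shows "- x * std_normal_cdf x \<le> std_normal_density x"
proof -
  define E where "E t = - std_normal_density t / x - std_normal_cdf t" for t
  have "(E has_real_derivative std_normal_density t * (t / x - 1)) (at t)" for t
    unfolding E_def using assms
    by (auto intro!: derivative_eq_intros DERIV_std_normal_density DERIV_std_normal_cdf simp: field_simps)
  moreover have "std_normal_density t * (t / x - 1) \<ge> 0" if "t \<le> x" for t
    using that assms by (intro mult_nonneg_nonneg) (auto simp: field_simps)
  ultimately have "E t \<le> E x" if "t \<le> x" for t
    using that by (intro DERIV_nonneg_imp_nondecreasing[of t x E]) auto
  moreover have "(E \<longlongrightarrow> - 0 / x - 0) at_bot"
    unfolding E_def
  proof (intro tendsto_intros std_normal_cdf_lims)
    show "(std_normal_density \<longlongrightarrow> 0) at_bot"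
      unfolding std_normal_density_def[abs_def] by real_asymp
  qed (use assms in auto)
  ultimately have "0 \<le> E x"
    by (intro tendsto_upperbound[of E 0 at_bot]) (auto simp: eventually_at_bot_linorder)
  then show ?thesis using assms by (simp add: E_def field_simps)
qed

text \<open>\<open>min u (1 - u)\<close> is at most the tail probability on the side given by the
  sign of the quantile, to which Mills' ratio applies.\<close>

lemma abs_quantile_mult_min_le:
  assumes "0 < u" "u < 1"
  shows "\<bar>std_normal_quantile u\<bar> * min u (1 - u) \<le> std_normal_density (std_normal_quantile u)"
proof -
  define x where "x = std_normal_quantile u"
  have u: "u = std_normal_cdf x" using cdf_quantile[OF assms] by (simp add: x_def)
  consider "x > 0" | "x = 0" | "x < 0" by linarith
  then have "\<bar>x\<bar> * min u (1 - u) \<le> std_normal_density x"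
  proof cases
    case 1
    then have "\<bar>x\<bar> * min u (1 - u) \<le> x * (1 - u)" by (simp add: mult_left_mono)
    then show ?thesis using upper_tail_le_density[OF 1] u by simp
  next
    case 3
    then have "\<bar>x\<bar> * min u (1 - u) \<le> - x * u" by (auto intro: mult_left_mono_neg)
    then show ?thesis using lower_tail_le_density[OF 3] u by simp
  qed simp
  then show ?thesis by (simp add: x_def)
qed

text \<open>Mills' ratio says little near the median, so the cases split at absolute value 1 of the
  quantile. Outside, it bounds the minimum by the density, and the density at 1 is at most 1.
  Inside, the density is at least its value at 1, while the minimum is at most 1.\<close>

lemma min_le_density_quantile:
  assumes "0 < u" "u < 1"
  shows "min u (1 - u) \<le> std_normal_density (std_normal_quantile u) / std_normal_density 1"
proof (cases "\<bar>std_normal_quantile u\<bar> \<ge> 1")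
  case True
  have "1 \<le> sqrt (2 * pi)" using pi_ge_two by simp
  then have "1 / sqrt (2 * pi) \<le> 1" by simp
  moreover have "exp (- 1\<^sup>2 / 2) \<le> (1::real)" by simp
  ultimately have "std_normal_density 1 \<le> 1 * 1"
    unfolding std_normal_density_def by (intro mult_mono) auto
  then have "min u (1 - u) * std_normal_density 1 \<le> min u (1 - u)"
    using assms by (intro mult_left_le) auto
  also have "\<dots> \<le> std_normal_density (std_normal_quantile u)"
    using abs_quantile_mult_min_le[OF assms] mult_right_mono[OF True, of "min u (1 - u)"] assms
    by (simp only: mult_1) linarith
  finally show ?thesis
    by (subst pos_le_divide_eq) (auto simp: normal_density_pos)
next
  case False
  then have "(std_normal_quantile u)\<^sup>2 \<le> 1\<^sup>2" by (subst power2_le_iff_abs_le) auto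
  then have "std_normal_density 1 \<le> std_normal_density (std_normal_quantile u)"
    unfolding std_normal_density_def by (intro mult_left_mono) auto
  moreover have "0 < std_normal_density 1" by (simp add: normal_density_pos)
  moreover have "min u (1 - u) \<le> 1" using assms by auto
  moreover have "min u (1 - u) * std_normal_density 1 \<le> 1 * std_normal_density 1"
    using assms by (intro mult_right_mono) auto
  ultimately show ?thesis
    unfolding pos_le_divide_eq[OF \<open>0 < std_normal_density 1\<close>] by linarith
qed

subsection \<open>Composition with the quantile map\<close>

abbreviation quantile_deriv :: "real \<Rightarrow> real" where
  "quantile_deriv u \<equiv> 1 / std_normal_density (std_normal_quantile u)"

text \<open>With \<open>q\<close> the quantile and \<open>\<phi>\<close> the density,
  \<open>q' = 1 / \<phi>(q)\<close>, and \<open>1 / \<phi>\<close> has derivative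
  \<open>x / \<phi>(x)\<close>. Hence the functions \<open>P(q) * q' ^ n\<close> are closed under
  differentiation, with new polynomial \<open>P' + n x P\<close>.\<close>

lemma DERIV_poly_quantile:
  assumes "0 < u" "u < 1"
  shows "((\<lambda>u. poly P (std_normal_quantile u) * quantile_deriv u ^ n) has_real_derivative
    poly (pderiv P + smult (real n) (pCons 0 P)) (std_normal_quantile u) * quantile_deriv u ^ Suc n) (at u)"
proof -
  have pos: "std_normal_density x \<noteq> 0" for x
    using normal_density_pos[of 1 0 x] by simp
  have "((\<lambda>x. 1 / std_normal_density x) has_real_derivative x * (1 / std_normal_density x)) (at x)" for x
    using pos by (auto intro!: derivative_eq_intros DERIV_std_normal_density)
  from DERIV_power[OF this, of n]
  have "((\<lambda>x. (1 / std_normal_density x) ^ n) has_real_derivative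
      real n * x * (1 / std_normal_density x) ^ n) (at x)" for x
    \<comment> \<open>The power rule leaves the exponent \<open>n - 1\<close>, which is truncated at
      \<open>n = 0\<close>.\<close>
    by (rule DERIV_cong) (cases n, auto)
  from DERIV_mult[OF poly_DERIV this, of P]
  have "((\<lambda>x. poly P x * (1 / std_normal_density x) ^ n) has_real_derivative
      poly (pderiv P + smult (real n) (pCons 0 P)) x * (1 / std_normal_density x) ^ n) (at x)" for x
    by (rule DERIV_cong) (simp add: algebra_simps)
  from DERIV_chain2[OF this DERIV_quantile[OF assms]] show ?thesis
    by simp
qed

lemma partial_deriv_coordinate:
  assumes "(\<phi> has_real_derivative D) (at (u $ i))"
  shows "has_partial_deriv j (\<lambda>u. \<phi> (u $ i)) u"
    and "partial_deriv j (\<lambda>u. \<phi> (u $ i)) u = (if i = j then D else 0)"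
proof -
  have "((\<lambda>h. \<phi> ((u + h *\<^sub>R axis j 1) $ i)) has_real_derivative (if i = j then D else 0)) (at 0)"
  proof (cases "i = j")
    case True
    have "((\<lambda>h. \<phi> (h + u $ i)) has_real_derivative D) (at 0)"
      using DERIV_shift[of \<phi> D 0 "u $ i"] assms by simp
    with True show ?thesis by (simp add: axis_def add.commute)
  qed (simp add: axis_def)
  from partial_derivI[of "\<lambda>u. \<phi> (u $ i)", OF this]
  show "has_partial_deriv j (\<lambda>u. \<phi> (u $ i)) u"
    "partial_deriv j (\<lambda>u. \<phi> (u $ i)) u = (if i = j then D else 0)" by auto
qed

section \<open>Smoothness on the open unit cube\<close>

lemma open_unit_cube: "open (unit_cube :: (real^'d::finite) set)"
proof -
  have "(unit_cube :: (real^'d) set) = box 0 (\<chi> k. 1)"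
    by (auto simp: unit_cube_def mem_box_cart)
  moreover have "open (box 0 (\<chi> k. 1) :: (real^'d) set)" by (rule open_box)
  ultimately show ?thesis by simp
qed

interpretation cube_alg: function_algebra unit_cube "{f. continuous_on (unit_cube :: (real^'d::finite) set) f}"
  by (rule function_algebra_continuous[OF open_unit_cube])

lemma continuous_on_coordinate_cube:
  assumes "\<And>x. 0 < x \<Longrightarrow> x < 1 \<Longrightarrow> isCont \<phi> x"
  shows "continuous_on unit_cube (\<lambda>u. \<phi> (u $ i))"
  by (rule continuous_on_compose2[of "{0<..<1}" \<phi>])
    (use assms in \<open>auto simp: unit_cube_def intro!: continuous_intros continuous_at_imp_continuous_on\<close>)

text \<open>\<open>P\<close> and \<open>n\<close> are arbitrary in the induction: a derivative in
  direction \<open>i\<close> stays in this family with a new polynomial and exponent, and one in any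
  other direction vanishes.\<close>

lemma Ck_on_poly_quantile:
  fixes i :: "'d::finite"
  shows "Ck_on k unit_cube (\<lambda>u. poly P (std_normal_quantile (u $ i)) * quantile_deriv (u $ i) ^ n)"
proof (induction k arbitrary: P n)
  case 0
  show ?case
    unfolding Ck_on.simps
    by (rule continuous_on_coordinate_cube[where \<phi> = "\<lambda>x. poly P (std_normal_quantile x) * quantile_deriv x ^ n"])
      (rule DERIV_isCont[OF DERIV_poly_quantile])
next
  case (Suc k)
  let ?f = "\<lambda>P n (u :: real^'d). poly P (std_normal_quantile (u $ i)) * quantile_deriv (u $ i) ^ n"
  have pd: "has_partial_deriv j (?f P n) u"
    "partial_deriv j (?f P n) u =
      (if i = j then ?f (pderiv P + smult (real n) (pCons 0 P)) (Suc n) u else 0)"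
    if "u \<in> unit_cube" for u j
    using partial_deriv_coordinate[where i = i and u = u and j = j, OF DERIV_poly_quantile[of "u $ i" P n]] that
    by (auto simp: unit_cube_def)
  have "continuous_on unit_cube (?f P n)"
    by (rule continuous_on_coordinate_cube[where \<phi> = "\<lambda>x. poly P (std_normal_quantile x) * quantile_deriv x ^ n"])
      (rule DERIV_isCont[OF DERIV_poly_quantile])
  moreover have "Ck_on k unit_cube (partial_deriv j (?f P n))" for j
  proof (cases "i = j")
    case True
    show ?thesis
      using cube_alg.Ck_in_cong[OF Suc.IH[of "pderiv P + smult (real n) (pCons 0 P)" "Suc n",
            unfolded Ck_on_eq_Ck_in]] pd(2) True
      unfolding Ck_on_eq_Ck_in by simp
  next
    case False
    show ?thesis
      unfolding Ck_on_eq_Ck_in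
      by (rule cube_alg.Ck_in_cong[OF cube_alg.Ck_in_const[of k 0]]) (use pd(2) False in simp)
  qed
  ultimately show ?case using pd(1) by simp
qed

text \<open>Moving \<open>u\<close> parallel to axis \<open>i\<close> moves its image parallel to
  the same axis, so the one-variable chain rule suffices and no total derivative of \<open>h\<close>
  enters.\<close>

lemma partial_deriv_quantile_map:
  assumes "u \<in> unit_cube" "has_partial_deriv i h (normal_quantile_map u)"
  shows "has_partial_deriv i (\<lambda>u. h (normal_quantile_map u)) u"
    and "partial_deriv i (\<lambda>u. h (normal_quantile_map u)) u
      = partial_deriv i h (normal_quantile_map u) * quantile_deriv (u $ i)"
proof -
  have u: "0 < u $ i" "u $ i < 1" using assms(1) by (auto simp: unit_cube_def)
  let ?q = "\<lambda>t. std_normal_quantile (t + u $ i) - std_normal_quantile (u $ i)"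
  have eq: "normal_quantile_map (u + t *\<^sub>R axis i 1) = normal_quantile_map u + ?q t *\<^sub>R axis i 1" for t
    by (auto simp: vec_eq_iff normal_quantile_map_def axis_def add.commute)
  have "((\<lambda>t. std_normal_quantile (t + u $ i)) has_real_derivative quantile_deriv (u $ i)) (at 0)"
    using DERIV_shift[of std_normal_quantile "quantile_deriv (u $ i)" 0 "u $ i"] DERIV_quantile[OF u] by simp
  then have "(?q has_real_derivative quantile_deriv (u $ i)) (at 0)"
    by (auto intro!: derivative_eq_intros)
  moreover have "((\<lambda>s. h (normal_quantile_map u + s *\<^sub>R axis i 1)) has_real_derivative
      partial_deriv i h (normal_quantile_map u)) (at (?q 0))"
    using assms(2) by (simp add: has_partial_deriv_iff)
  ultimately have "((\<lambda>t. h (normal_quantile_map (u + t *\<^sub>R axis i 1))) has_real_derivative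
      partial_deriv i h (normal_quantile_map u) * quantile_deriv (u $ i)) (at 0)"
    unfolding eq by (rule DERIV_chain2[rotated])
  from partial_derivI[of "\<lambda>u. h (normal_quantile_map u)", OF this]
  show "has_partial_deriv i (\<lambda>u. h (normal_quantile_map u)) u"
    "partial_deriv i (\<lambda>u. h (normal_quantile_map u)) u
      = partial_deriv i h (normal_quantile_map u) * quantile_deriv (u $ i)" by auto
qed

lemma continuous_on_normal_quantile_map: "continuous_on unit_cube normal_quantile_map"
  unfolding normal_quantile_map_def[abs_def]
  by (intro continuous_on_vec_lambda continuous_on_coordinate_cube DERIV_isCont[OF DERIV_quantile])

lemma Ck_on_compose_quantile_map:
  "Ck_on k UNIV h \<Longrightarrow> Ck_on k unit_cube (\<lambda>u. h (normal_quantile_map u))"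
proof (induction k arbitrary: h)
  case 0
  then show ?case
    by (auto intro: continuous_on_compose2[OF _ continuous_on_normal_quantile_map])
next
  case (Suc k)
  have "Ck_on k unit_cube (partial_deriv i (\<lambda>u. h (normal_quantile_map u)))" for i
  proof -
    have "Ck_on k unit_cube (\<lambda>u. quantile_deriv (u $ i))"
      \<comment> \<open>The factor from the chain rule is the member \<open>P = 1\<close>,
        \<open>n = 1\<close> of the polynomial family.\<close>
      using Ck_on_poly_quantile[of k 1 i 1] by simp
    moreover have "Ck_on k unit_cube (\<lambda>u. partial_deriv i h (normal_quantile_map u))"
      using Suc by auto
    ultimately have "Ck_on k unit_cube (\<lambda>u. partial_deriv i h (normal_quantile_map u) * quantile_deriv (u $ i))"
      unfolding Ck_on_eq_Ck_in by (rule cube_alg.Ck_in_mult[rotated])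
    then show ?thesis
      unfolding Ck_on_eq_Ck_in
      by (rule cube_alg.Ck_in_cong) (use Suc.prems in \<open>simp add: partial_deriv_quantile_map(2)\<close>)
  qed
  moreover have "continuous_on unit_cube (\<lambda>u. h (normal_quantile_map u))"
    using Suc.prems by (auto intro: continuous_on_compose2[OF _ continuous_on_normal_quantile_map])
  ultimately show ?case
    using Suc.prems by (simp add: partial_deriv_quantile_map(1)[of _ _ h])
qed

lemma partial_deriv_prod_coordinates:
  fixes M :: "'d::finite set"
  assumes "(\<phi> has_real_derivative D) (at (u $ i))"
  shows "has_partial_deriv i (\<lambda>u. \<Prod>k\<in>M. \<phi> (u $ k)) u"
    and "partial_deriv i (\<lambda>u. \<Prod>k\<in>M. \<phi> (u $ k)) u
      = (if i \<in> M then D * (\<Prod>k\<in>M - {i}. \<phi> (u $ k)) else 0)"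
proof -
  have rest: "(\<Prod>k\<in>M - {i}. \<phi> ((u + h *\<^sub>R axis i 1) $ k)) = (\<Prod>k\<in>M - {i}. \<phi> (u $ k))" for h
    by (intro prod.cong) (auto simp: axis_def)
  have "((\<lambda>h. \<Prod>k\<in>M. \<phi> ((u + h *\<^sub>R axis i 1) $ k)) has_real_derivative
      (if i \<in> M then D * (\<Prod>k\<in>M - {i}. \<phi> (u $ k)) else 0)) (at 0)"
  proof (cases "i \<in> M")
    case True
    then have "(\<Prod>k\<in>M. \<phi> ((u + h *\<^sub>R axis i 1) $ k)) = \<phi> (h + u $ i) * (\<Prod>k\<in>M - {i}. \<phi> (u $ k))" for h
      using prod.remove[OF finite True, of "\<lambda>k. \<phi> ((u + h *\<^sub>R axis i 1) $ k)"] rest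
      by (simp add: axis_def add.commute)
    moreover have "((\<lambda>h. \<phi> (h + u $ i)) has_real_derivative D) (at 0)"
      using DERIV_shift[of \<phi> D 0 "u $ i"] assms by simp
    ultimately show ?thesis
      using True by (auto intro!: DERIV_cmult_right)
  next
    case False
    then show ?thesis using rest by simp
  qed
  from partial_derivI[of "\<lambda>u. \<Prod>k\<in>M. \<phi> (u $ k)", OF this]
  show "has_partial_deriv i (\<lambda>u. \<Prod>k\<in>M. \<phi> (u $ k)) u"
    "partial_deriv i (\<lambda>u. \<Prod>k\<in>M. \<phi> (u $ k)) u
      = (if i \<in> M then D * (\<Prod>k\<in>M - {i}. \<phi> (u $ k)) else 0)" by auto
qed

lemma DERIV_quantile_deriv:
  assumes "0 < u" "u < 1"
  shows "(quantile_deriv has_real_derivative std_normal_quantile u * quantile_deriv u ^ 2) (at u)"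
  using DERIV_poly_quantile[OF assms, of 1 1] by (simp add: power2_eq_square pderiv_1)

text \<open>
  The coordinatewise map turns each differentiation of the outer function into one factor; only a
  repeated coordinate, excluded here, would differentiate such a factor again.
\<close>

lemma iterated_partial_quantile_map:
  assumes "distinct is" "Ck_on (length is) UNIV h" "u \<in> unit_cube"
  shows "foldr partial_deriv is (\<lambda>u. h (normal_quantile_map u)) u
    = foldr partial_deriv is h (normal_quantile_map u) * (\<Prod>k\<in>set is. quantile_deriv (u $ k))"
  using assms
proof (induction "is" arbitrary: u)
  case (Cons i "is")
  have i: "i \<notin> set is" "distinct is" using Cons.prems by auto
  have u: "0 < u $ i" "u $ i < 1" using Cons.prems by (auto simp: unit_cube_def)
  have "Ck_on 1 UNIV (foldr partial_deriv is h)"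
    using Ck_on_iterated[of 1 "is"] Cons.prems by (simp del: Ck_on.simps)
  then have h: "has_partial_deriv i (foldr partial_deriv is h) z" for z
    by auto
  let ?p = "\<lambda>u. \<Prod>k\<in>set is. quantile_deriv (u $ k)"
  have "foldr partial_deriv (i # is) (\<lambda>u. h (normal_quantile_map u)) u
      = partial_deriv i (\<lambda>u. foldr partial_deriv is h (normal_quantile_map u) * ?p u) u"
    unfolding foldr.simps o_def
    by (rule partial_deriv_cong_open(2)[OF open_unit_cube Cons.prems(3)])
      (use Cons.IH[OF i(2)] Ck_on_mono[OF Cons.prems(2), of "length is"] in \<open>auto simp: o_def\<close>)
  also have "\<dots> = partial_deriv i (\<lambda>u. foldr partial_deriv is h (normal_quantile_map u)) u * ?p u
      + foldr partial_deriv is h (normal_quantile_map u) * partial_deriv i ?p u"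
    by (intro partial_deriv_mult partial_deriv_quantile_map h Cons.prems
        partial_deriv_prod_coordinates[OF DERIV_quantile_deriv[OF u]])
  \<comment> \<open>The second summand vanishes, since \<open>i\<close> does not occur in
    \<open>is\<close>.\<close>
  also have "\<dots> = foldr partial_deriv (i # is) h (normal_quantile_map u) * (quantile_deriv (u $ i) * ?p u)"
    using partial_deriv_prod_coordinates(2)[OF DERIV_quantile_deriv[OF u], of "set is"]
      partial_deriv_quantile_map(2)[OF Cons.prems(3) h] i(1) by simp
  finally show ?case using i(1) by simp
qed simp

subsection \<open>The Euler steps and the derivative estimate\<close>

text \<open>Each step adds a bounded function with bounded derivatives. The invariant concerns first
  partial derivatives, since the components start from the identity and need not be bounded.
  \<open>V\<close> is one order better than the invariant because its composition with the iterate
  is differentiated once.\<close>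

lemma euler_steps_partials_bounded:
  fixes V :: "real^'d::finite \<Rightarrow> real \<Rightarrow> real^'d"
  assumes V: "\<And>j k. k < K \<Longrightarrow>
      Ck_in bounded_continuous (Suc d) UNIV (\<lambda>x. V x (T - real k * (T / real K)) $ j)"
    and "n \<le> K"
  shows "continuous_on UNIV (euler_steps V T K n)"
    and "\<And>j i x. has_partial_deriv i (\<lambda>x. euler_steps V T K n x $ j) x"
    and "\<And>j i. Ck_in bounded_continuous d UNIV (partial_deriv i (\<lambda>x. euler_steps V T K n x $ j))"
  using assms(2)
proof (induction n)
  case 0
  {
    case 1
    show ?case by (simp add: id_def)
  next
    case 2
    show ?case by (simp add: partial_deriv_component)
  next
    case 3
    show ?case by (simp add: partial_deriv_component bounded_alg.Ck_in_const)
  }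
next
  case (Suc n)
  define X where "X = euler_steps V T K n"
  define t where "t = T - real n * (T / real K)"
  have X: "continuous_on UNIV X" "has_partial_deriv i (\<lambda>x. X x $ j) x"
    "Ck_in bounded_continuous d UNIV (partial_deriv i (\<lambda>x. X x $ j))"
    if "Suc n \<le> K" for i j x
    using Suc that by (auto simp: X_def)
  have step: "euler_steps V T K (Suc n) = (\<lambda>x. X x - (T / real K) *\<^sub>R V (X x) t)"
    by (auto simp: X_def t_def euler_step_def Let_def)
  have comp: "(\<lambda>x. euler_steps V T K (Suc n) x $ j)
      = (\<lambda>x. X x $ j + - (T / real K) * V (X x) t $ j)" for j
    unfolding step by simp
  have VX: "Ck_in bounded_continuous (Suc d) UNIV (\<lambda>x. - (T / real K) * V (X x) t $ j)"
    if "Suc n \<le> K" for j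
  proof -
    have "Ck_in bounded_continuous (Suc d) UNIV (\<lambda>x. V x t $ j)"
      using V[of n j] that by (simp only: t_def Suc_le_eq)
    then have "Ck_in bounded_continuous (Suc d) UNIV (\<lambda>x. V (X x) t $ j)"
      by (rule Ck_in_bounded_compose[where h = "\<lambda>x. V x t $ j" and X = X, OF X[OF that] order_refl])
    then show ?thesis
      by (rule bounded_alg.Ck_in_mult[OF bounded_alg.Ck_in_const])
  qed
  {
    case 1
    have "continuous_on UNIV (\<lambda>x. euler_steps V T K (Suc n) x $ j)" for j
      unfolding comp using Ck_in_imp_mem[OF VX[OF 1]]
      by (intro continuous_on_add continuous_on_component X(1)[OF 1]) simp
    then have "continuous_on UNIV (\<lambda>x. \<chi> j. euler_steps V T K (Suc n) x $ j)"
      by (intro continuous_on_vec_lambda)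
    then show ?case by (simp only: vec_nth_inverse)
  next
    case 2
    show ?case
      unfolding comp using X(2)[OF 2] VX[OF 2] by (intro partial_deriv_add) auto
  next
    case 3
    have "partial_deriv i (\<lambda>x. euler_steps V T K (Suc n) x $ j)
        = (\<lambda>x. partial_deriv i (\<lambda>x. X x $ j) x + partial_deriv i (\<lambda>x. - (T / real K) * V (X x) t $ j) x)"
      unfolding comp using X(2)[OF 3] VX[OF 3] by (intro ext partial_deriv_add(2)) auto
    then show ?case
      using bounded_alg.Ck_in_add[OF X(3)[OF 3]] VX[OF 3] by simp
  }
qed

section \<open>Boundary growth of the quantile derivatives and the final estimate\<close>

lemma quantile_deriv_le:
  assumes "0 < u" "u < 1"
  shows "quantile_deriv u \<le> 1 / std_normal_density 1 * (1 / min u (1 - u))"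
  using min_le_density_quantile[OF assms] assms normal_density_pos[of 1 0]
  by (simp add: field_simps)

text \<open>Split as \<open>(q * q') * q'\<close>: Mills' ratio bounds the first factor by
  \<open>1 / min u (1 - u)\<close> without a constant, so only the last factor contributes
  \<open>1 / std_normal_density 1\<close>.\<close>

lemma abs_DERIV_quantile_deriv_le:
  assumes "0 < u" "u < 1"
  shows "\<bar>std_normal_quantile u * quantile_deriv u ^ 2\<bar>
    \<le> 1 / std_normal_density 1 * (1 / min u (1 - u))\<^sup>2"
proof -
  have m: "0 < min u (1 - u)" using assms by simp
  have \<phi>: "0 < std_normal_density x" for x by (simp add: normal_density_pos)
  have "\<bar>std_normal_quantile u\<bar> * quantile_deriv u \<le> 1 / min u (1 - u)"
    using abs_quantile_mult_min_le[OF assms] m \<phi> by (simp add: pos_le_divide_eq pos_divide_le_eq)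
  then have "(\<bar>std_normal_quantile u\<bar> * quantile_deriv u) * quantile_deriv u
      \<le> 1 / min u (1 - u) * (1 / std_normal_density 1 * (1 / min u (1 - u)))"
    using quantile_deriv_le[OF assms] m \<phi> by (intro mult_mono) (auto simp: less_imp_le)
  then show ?thesis
    using \<phi> by (simp add: abs_mult power2_eq_square ac_simps)
qed

lemma prod_quantile_deriv_le:
  assumes "u \<in> unit_cube"
  shows "(\<Prod>k\<in>M. quantile_deriv (u $ k))
    \<le> (1 / std_normal_density 1) ^ card M * (\<Prod>k\<in>M. 1 / min (u $ k) (1 - u $ k))"
proof -
  have "(\<Prod>k\<in>M. quantile_deriv (u $ k))
      \<le> (\<Prod>k\<in>M. 1 / std_normal_density 1 * (1 / min (u $ k) (1 - u $ k)))"
    using assms by (intro prod_mono conjI quantile_deriv_le) (auto simp: unit_cube_def)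
  then show ?thesis by (simp only: prod.distrib prod_constant)
qed

text \<open>The extra derivative in direction \<open>i\<close> is kept outermost, so that the
  formula for distinct coordinates applies to the inner ones. It falls either on the outer function,
  giving a new factor \<open>q'\<close>, or, if \<open>i\<close> is in \<open>is\<close>, on the
  existing factor of coordinate \<open>i\<close>, giving \<open>q''\<close>. Either way one more
  weight of coordinate \<open>i\<close> appears.\<close>

lemma partial_deriv_iterated_quantile_map_bound:
  fixes h :: "real^'d::finite \<Rightarrow> real"
  assumes "distinct is" and h: "Ck_on (Suc (length is)) UNIV h"
    and bd: "\<And>js. 0 < length js \<Longrightarrow> length js \<le> Suc (length is) \<Longrightarrow>
      \<exists>M. \<forall>x. \<bar>foldr partial_deriv js h x\<bar> \<le> M"
  shows "\<exists>C\<ge>0. \<forall>u\<in>unit_cube.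
    \<bar>partial_deriv i (foldr partial_deriv is (\<lambda>u. h (normal_quantile_map u))) u\<bar>
      \<le> C * (1 / min (u $ i) (1 - u $ i)) * (\<Prod>k\<in>set is. 1 / min (u $ k) (1 - u $ k))"
proof -
  let ?G = "normal_quantile_map :: real^'d \<Rightarrow> real^'d"
  let ?p = "\<lambda>u. \<Prod>k\<in>set is. quantile_deriv (u $ k)"
  let ?m = "\<lambda>u k. 1 / min (u $ k) (1 - u $ k) :: real"
  define c where "c = 1 / std_normal_density 1"
  have c: "0 \<le> c" by (simp add: c_def)
  obtain M where M: "\<And>x. \<bar>foldr partial_deriv (i # is) h x\<bar> \<le> M"
    using bd[of "i # is"] by auto
  \<comment> \<open>For an empty list no bound on \<open>h\<close> itself is available; the term
    with \<open>N\<close> then vanishes, because its derivative falls on an empty product.\<close>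
  obtain N where N: "is \<noteq> [] \<Longrightarrow> \<bar>foldr partial_deriv is h x\<bar> \<le> N" for x
    using bd[of "is"] by (cases "is = []") auto
  have "0 \<le> M" using M[of 0] by linarith
  have "Ck_on 1 UNIV (foldr partial_deriv is h)"
    using Ck_on_iterated[of 1 "is"] h by (simp del: Ck_on.simps)
  then have h1: "has_partial_deriv i (foldr partial_deriv is h) z" for z by auto
  \<comment> \<open>The first constant comes from differentiating the outer function again, the
    second from differentiating a quantile factor. The absolute value is taken because
    \<open>N\<close> is unconstrained for empty \<open>is\<close>.\<close>
  have bound: "\<bar>partial_deriv i (foldr partial_deriv is (\<lambda>u. h (?G u))) u\<bar>
      \<le> (M * c ^ Suc (length is) + \<bar>N\<bar> * c ^ length is) * ?m u i * (\<Prod>k\<in>set is. ?m u k)"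
    if cube: "u \<in> unit_cube" for u
  proof -
    have u: "0 < u $ k" "u $ k < 1" for k using cube by (auto simp: unit_cube_def)
    then have m: "0 \<le> ?m u k" for k by (simp add: less_imp_le)
    have q: "0 \<le> quantile_deriv x" for x by simp
    note dp = partial_deriv_prod_coordinates[OF DERIV_quantile_deriv[OF u(1)[of i] u(2)[of i]], of "set is"]
    have eq: "partial_deriv i (foldr partial_deriv is (\<lambda>u. h (?G u))) u
      = foldr partial_deriv (i # is) h (?G u) * quantile_deriv (u $ i) * ?p u
        + foldr partial_deriv is h (?G u) * partial_deriv i ?p u"
    proof -
      have "partial_deriv i (foldr partial_deriv is (\<lambda>u. h (?G u))) u
          = partial_deriv i (\<lambda>u. foldr partial_deriv is h (?G u) * ?p u) u"
        by (rule partial_deriv_cong_open(2)[OF open_unit_cube cube])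
          (rule iterated_partial_quantile_map[OF assms(1) Ck_on_mono[OF h]], auto)
      also have "\<dots> = partial_deriv i (\<lambda>u. foldr partial_deriv is h (?G u)) u * ?p u
          + foldr partial_deriv is h (?G u) * partial_deriv i ?p u"
        by (intro partial_deriv_mult partial_deriv_quantile_map h1 cube dp)
      finally show ?thesis
        by (simp add: partial_deriv_quantile_map(2)[OF cube h1])
    qed
    have p: "?p u \<le> c ^ length is * (\<Prod>k\<in>set is. ?m u k)"
      using prod_quantile_deriv_le[OF cube, of "set is"] assms(1) by (simp add: c_def distinct_card)
    have p0: "0 \<le> ?p u" by (intro prod_nonneg) auto
    have first: "\<bar>foldr partial_deriv (i # is) h (?G u) * quantile_deriv (u $ i) * ?p u\<bar>
        \<le> M * (c * ?m u i) * (c ^ length is * (\<Prod>k\<in>set is. ?m u k))"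
      unfolding abs_mult abs_of_nonneg[OF q] abs_of_nonneg[OF p0]
      using M[of "?G u"] quantile_deriv_le[OF u] \<open>0 \<le> M\<close> c m[of i] p p0
      by (intro mult_mono) (auto simp: c_def)
    have second: "\<bar>foldr partial_deriv is h (?G u) * partial_deriv i ?p u\<bar>
        \<le> \<bar>N\<bar> * (c ^ length is * (?m u i * (\<Prod>k\<in>set is. ?m u k)))"
    proof (cases "i \<in> set is")
      case True
      define v where "v = set is - {i}"
      \<comment> \<open>The constant from \<open>q''\<close> stands in for the missing coordinate
        \<open>i\<close>: \<open>c * c ^ card v\<close> equals \<open>c ^ length is\<close>.\<close>
      have card: "length is = Suc (card v)"
        using True assms(1) length_pos_if_in_set[OF True] by (simp add: v_def distinct_card)
      have "\<bar>partial_deriv i ?p u\<bar>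
          = \<bar>std_normal_quantile (u $ i) * quantile_deriv (u $ i) ^ 2\<bar> * (\<Prod>k\<in>v. quantile_deriv (u $ k))"
        unfolding dp(2) using True prod_nonneg[of v "\<lambda>k. quantile_deriv (u $ k)"]
        by (simp only: if_True abs_mult v_def[symmetric]) (simp del: divide_const_simps)
      also have "\<dots> \<le> (c * (?m u i)\<^sup>2) * (c ^ card v * (\<Prod>k\<in>v. ?m u k))"
        using abs_DERIV_quantile_deriv_le[OF u(1)[of i] u(2)[of i]] prod_quantile_deriv_le[OF cube, of v] c
        by (intro mult_mono) (auto simp: c_def intro!: prod_nonneg)
      also have "\<dots> = c ^ length is * (?m u i * (?m u i * (\<Prod>k\<in>v. ?m u k)))"
        unfolding card power2_eq_square power_Suc by (simp only: ac_simps)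
      \<comment> \<open>Of the two weights of coordinate \<open>i\<close>, one completes the product
        over \<open>set is\<close>; the other is the extra factor.\<close>
      also have "?m u i * (\<Prod>k\<in>v. ?m u k) = (\<Prod>k\<in>set is. ?m u k)"
        unfolding v_def using True by (subst (2) prod.remove[of _ i]) auto
      finally have "\<bar>partial_deriv i ?p u\<bar> \<le> c ^ length is * (?m u i * (\<Prod>k\<in>set is. ?m u k))" .
      moreover have "is \<noteq> []" using True by auto
      ultimately show ?thesis
        unfolding abs_mult using N[of "?G u"] by (intro mult_mono) auto
    next
      case False
      then show ?thesis
        unfolding dp(2) using c
        by (simp only: if_False mult_zero_right abs_zero)
          (intro mult_nonneg_nonneg prod_nonneg m zero_le_power ballI, auto)
    qed
    show ?thesis
      unfolding eq using order_trans[OF abs_triangle_ineq add_mono[OF first second]]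
      by (simp add: algebra_simps)
  qed
  show ?thesis
    by (rule exI[of _ "M * c ^ Suc (length is) + \<bar>N\<bar> * c ^ length is"])
      (use bound c \<open>0 \<le> M\<close> in auto)
qed

text \<open>Each minimum lies between 0 and 1, so the exponent \<open>- B\<close> only enlarges the
  right-hand side; the left-hand side is the weight for \<open>B = 0\<close>.\<close>

lemma weight_le:
  fixes u :: "real^'d::finite"
  assumes "u \<in> unit_cube" "0 < B"
  shows "1 / min (u $ i) (1 - u $ i) * (\<Prod>k\<in>v. 1 / min (u $ k) (1 - u $ k))
    \<le> min (u $ i) (1 - u $ i) powr (-1) * (\<Prod>k\<in>UNIV. min (u $ k) (1 - u $ k) powr (- B - indicator v k))"
proof -
  have m: "0 < min (u $ k) (1 - u $ k)" "min (u $ k) (1 - u $ k) \<le> 1" for k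
    using assms(1) by (auto simp: unit_cube_def)
  have inv: "1 / min (u $ k) (1 - u $ k) = min (u $ k) (1 - u $ k) powr (-1)" for k
    using m(1)[of k] by (simp add: powr_minus inverse_eq_divide)
  have "(\<Prod>k\<in>v. 1 / min (u $ k) (1 - u $ k)) = (\<Prod>k\<in>UNIV. if k \<in> v then 1 / min (u $ k) (1 - u $ k) else 1)"
    by (simp add: prod.If_cases)
  also have "\<dots> = (\<Prod>k\<in>UNIV. min (u $ k) (1 - u $ k) powr (- indicator v k))"
    using m by (intro prod.cong) (auto simp: inv indicator_def less_imp_neq[symmetric])
  also have "\<dots> \<le> (\<Prod>k\<in>UNIV. min (u $ k) (1 - u $ k) powr (- B - indicator v k))"
    using m assms(2) by (intro prod_mono conjI powr_mono') (auto simp: less_imp_le)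
  finally show ?thesis
    unfolding inv[of i] by (intro mult_left_mono) auto
qed

lemma mixed_partial_quantile_map_bound:
  fixes h :: "real^'d::finite \<Rightarrow> real" and v :: "'d set"
  assumes h: "Ck_on (Suc CARD('d)) UNIV h"
    and bd: "\<And>js. 0 < length js \<Longrightarrow> length js \<le> Suc CARD('d) \<Longrightarrow>
      \<exists>M. \<forall>x. \<bar>foldr partial_deriv js h x\<bar> \<le> M"
    and "0 < B"
  shows "\<exists>C>0. \<forall>u\<in>unit_cube.
    \<bar>mixed_partial (indicator v) (partial_deriv i (\<lambda>u. h (normal_quantile_map u))) u\<bar>
      \<le> C * min (u $ i) (1 - u $ i) powr (-1) *
         (\<Prod>k\<in>UNIV. min (u $ k) (1 - u $ k) powr (- B - indicator v k))"
proof -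
  let ?f = "\<lambda>u. h (normal_quantile_map u)"
  \<comment> \<open>Repetition-free, as the product formula requires; hence at most
    \<open>CARD('d)\<close> entries, and the total order stays within
    \<open>Suc CARD('d)\<close>.\<close>
  obtain L where L: "set L = v" "distinct L"
    using finite_distinct_list[of v] by auto
  have len: "length L \<le> CARD('d)"
    using L card_mono[of UNIV v] distinct_card[of L] by simp
  obtain C where C: "0 \<le> C" "\<And>u. u \<in> unit_cube \<Longrightarrow> \<bar>partial_deriv i (foldr partial_deriv L ?f) u\<bar>
      \<le> C * (1 / min (u $ i) (1 - u $ i)) * (\<Prod>k\<in>v. 1 / min (u $ k) (1 - u $ k))"
    using partial_deriv_iterated_quantile_map_bound[OF L(2) Ck_on_mono[OF h] bd, of i] len L(1)
    by auto
  have f: "Ck_on (Suc (length L)) unit_cube ?f"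
    using len by (intro Ck_on_compose_quantile_map Ck_on_mono[OF h]) auto
  have eq: "mixed_partial (indicator v) (partial_deriv i ?f) u = partial_deriv i (foldr partial_deriv L ?f) u"
    if "u \<in> unit_cube" for u
  proof -
    have "mixed_partial (indicator v) (partial_deriv i ?f) u = foldr partial_deriv L (partial_deriv i ?f) u"
    proof (rule mixed_partial_eq[OF open_unit_cube that])
      show "count_list L k = indicator v k" for k
        using L distinct_count_atmost_1[of L] by (auto simp: indicator_def count_mset[symmetric])
    qed (use f in auto)
    \<comment> \<open>The statement differentiates in direction \<open>i\<close> first, the bound
      has it last. Both sequences have the same multiset, even if \<open>i\<close> lies in
      \<open>v\<close>.\<close>
    also have "\<dots> = foldr partial_deriv (i # L) ?f u"
      using iterated_partial_mset[OF open_unit_cube that, of "L @ [i]" "i # L" ?f] f by simp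
    finally show ?thesis by simp
  qed
  show ?thesis
  \<comment> \<open>\<open>C\<close> may be 0, whereas the constant has to be positive.\<close>
  proof (intro exI[of _ "C + 1"] conjI ballI)
    fix u :: "real^'d" assume u: "u \<in> unit_cube"
    let ?w = "min (u $ i) (1 - u $ i) powr (-1) *
      (\<Prod>k\<in>UNIV. min (u $ k) (1 - u $ k) powr (- B - indicator v k))"
    have "\<bar>mixed_partial (indicator v) (partial_deriv i ?f) u\<bar> \<le> C * ?w"
      using C(2)[OF u] mult_left_mono[OF weight_le[OF u \<open>0 < B\<close>, of i v] C(1)]
      unfolding eq[OF u] by (simp only: mult.assoc)
    also have "\<dots> \<le> (C + 1) * ?w"
      by (intro mult_right_mono mult_nonneg_nonneg prod_nonneg) auto
    finally show "\<bar>mixed_partial (indicator v) (partial_deriv i ?f) u\<bar>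
      \<le> (C + 1) * min (u $ i) (1 - u $ i) powr (-1) *
        (\<Prod>k\<in>UNIV. min (u $ k) (1 - u $ k) powr (- B - indicator v k))"
      by (simp only: mult.assoc)
  qed (use C in auto)
qed

text \<open>\<open>deriv\<close> is total and \<open>mixed_partial\<close> picks an arbitrary order,
  so an estimate alone could concern junk values. The first conjunct ensures that the estimated
  derivatives, of order at most \<open>CARD('d) + 1\<close>, exist and do not depend on the order of
  differentiation.\<close>

theorem theorem5p6:
  fixes f s :: "real^'d::finite \<Rightarrow> real \<Rightarrow> real^'d"
    and g :: "real \<Rightarrow> real"
    and T :: real and K :: nat
    and V :: "real^'d \<Rightarrow> real \<Rightarrow> real^'d"
    and \<tau> :: "real^'d \<Rightarrow> real^'d"
  defines "V \<equiv> flow_field f g s"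
    and "\<tau> \<equiv> transport_map V T K"
  assumes "T > 0" and "K \<ge> 1"
    and smooth: "\<forall>j. \<forall>t\<in>{0..T}. Ck_on (CARD('d) + 1) UNIV (\<lambda>x. V x t $ j)"
    and bounded: "\<forall>\<beta> :: 'd \<Rightarrow> nat. (\<Sum>i\<in>UNIV. \<beta> i) \<le> CARD('d) + 1 \<longrightarrow>
      (\<exists>M. \<forall>j. \<forall>x. \<forall>t\<in>{0..T}. \<bar>mixed_partial \<beta> (\<lambda>x. V x t $ j) x\<bar> \<le> M)"
  shows "(\<forall>j. Ck_on (CARD('d) + 1) unit_cube (\<lambda>u. \<tau> u $ j)) \<and>
    (\<forall>v :: 'd set. \<forall>i j. \<forall>B>0. \<exists>C3>0. \<forall>u\<in>unit_cube.
      \<bar>mixed_partial (indicator v) (partial_deriv i (\<lambda>u. \<tau> u $ j)) u\<bar>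
        \<le> C3 * min (u $ i) (1 - u $ i) powr (-1) *
           (\<Prod>k\<in>UNIV. min (u $ k) (1 - u $ k) powr (- B - indicator v k)))"
proof -
  have V: "Ck_in bounded_continuous (Suc CARD('d)) UNIV (\<lambda>x. V x t $ j)" if t: "t \<in> {0..T}" for j t
  proof (rule Ck_in_bounded_if_mixed_partials_bounded)
    show "Ck_on (Suc CARD('d)) UNIV (\<lambda>x. V x t $ j)"
      using smooth t by (metis Suc_eq_plus1)
    show "bounded (range (mixed_partial \<beta> (\<lambda>x. V x t $ j)))" if "(\<Sum>i\<in>UNIV. \<beta> i) \<le> Suc CARD('d)" for \<beta>
    proof -
      obtain M where "\<forall>j x. \<forall>t\<in>{0..T}. \<bar>mixed_partial \<beta> (\<lambda>x. V x t $ j) x\<bar> \<le> M"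
        using bounded[rule_format, of \<beta>] \<open>_ \<le> Suc _\<close> by auto
      with t show ?thesis unfolding bounded_iff real_norm_def by blast
    qed
  qed
  have t: "T - real k * (T / real K) \<in> {0..T}" if "k < K" for k
    using mult_right_mono[of "real k" "real K" "T / real K"] that \<open>T > 0\<close> by simp
  define F where "F = euler_steps V T K K"
  have \<tau>: "\<tau> u = F (normal_quantile_map u)" for u
    by (simp add: \<tau>_def transport_map_def F_def)
  note F = euler_steps_partials_bounded[where V = V and T = T and K = K and n = K, OF V[OF t] order_refl, folded F_def]
  have smoothF: "Ck_on (Suc CARD('d)) UNIV (\<lambda>x. F x $ j)" for j
    using F(1,2) Ck_in_bounded_imp_Ck_on[OF F(3)] by (auto intro!: continuous_intros)
  have "\<exists>M. \<forall>x. \<bar>foldr partial_deriv js (\<lambda>x. F x $ j) x\<bar> \<le> M"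
    if "0 < length js" "length js \<le> Suc CARD('d)" for js j
  proof (cases js rule: rev_cases)
    \<comment> \<open>The last entry is differentiated first and turns a component of
      \<open>F\<close> into a bounded function; the remaining \<open>ks\<close> has length at most
      \<open>CARD('d)\<close>.\<close>
    case (snoc ks i)
    then show ?thesis
      using Ck_in_bounded_iterated[OF F(3)[of i j], of ks] that by auto
  qed (use that in auto)
  from mixed_partial_quantile_map_bound[OF smoothF this]
  show ?thesis
    unfolding \<tau> using Ck_on_compose_quantile_map[OF smoothF] by simp
qed

end
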